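(* Consider the independent block-fading binary symmetric wiretap channel with parameters $q_1,q_1^*\in[0,1]$ satisfying $q_1\ge q_1^*$, $q_2=1-q_1$, $q_2^*=1-q_1^*$, and crossover probabilities satisfying $p_1\le p_1^*\le p_2\le p_2^*\le 0.5$. Its secrecy capacity with channel state information available only at the decoders satisfies $$C^s_{\textrm{CSI-D}}\ge [H(p_1^* )-H(p_1)]\,q_1+[H(p_2^* )-H(p_2)]\,q_2^*+[H(p_2)-H(p_1^* )]\,(q_1-q_1^* ).$$
   Context: $H(p)=-p\log_2 p-(1-p)\log_2(1-p)$ is the binary entropy function, and BSC$(p)$ denotes the binary symmetric channel with crossover probability $p$. Independent block-fading binary symmetric wiretap channel: the transmitter sends $NB$ binary symbols $X_{1:NB}$ organized in $B$ fading blocks of length $N$. Each block $k$ has a main-channel state $S_k\in\{1,2\}$ with $\Pr(S_k=1)=q_1$ and an eavesdropper-channel state $S^*_k\in\{1,2\}$ with $\Pr(S_k^*=1)=q_1^*$; all these states are mutually independent (across blocks and between the two channels) and constant within a block. Within block $k$, the legitimate receiver observes the output $Y$ of $N$ independent uses of BSC$(p_{S_k})$, and the eavesdropper observes the output $Z$ of $N$ independent uses of BSC$(p^*_{S^*_k})$. Let $\mathsf{S}$ denote all the state realizations $(S_k,S_k^* )_{k=1}^B$. A code consists of a (possibly randomized) encoder $X_{1:NB}=f(\mathsf{M})$ of a uniformly distributed message $\mathsf{M}$, which knows only the state distributions (not the realizations), and a decoder $\hat{\mathsf{M}}=g(Y_{1:NB},\mathsf{S})$; its rate is $\frac{1}{NB}\log_2$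 of the message-set size. A rate $R$ is achievable if there are such codes of rate at least $R$ (asymptotically) with $N,B\to\infty$ such that $\Pr\{\mathsf{M}\ne\hat{\mathsf{M}}\}\to0$ and $\frac{1}{NB}I(\mathsf{M};Z_{1:NB}\mid\mathsf{S})\to 0$. $C^s_{\textrm{CSI-D}}$ is the supremum of achievable rates. *)

theory Defs
  imports "HOL-Probability.Probability"
begin

text \<open>Binary entropy (with log 2 0 = 0, hence 0 log 0 = 0).\<close>
definition Hb :: "real \<Rightarrow> real" where
  "Hb p = - p * log 2 p - (1 - p) * log 2 (1 - p)"

fun iid_list :: "nat \<Rightarrow> 'a pmf \<Rightarrow> 'a list pmf" where
  "iid_list 0 d = return_pmf []"
| "iid_list (Suc n) d = do { x \<leftarrow> d; xs \<leftarrow> iid_list n d; return_pmf (x # xs) }"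

fun bsc_list :: "real list \<Rightarrow> bool list \<Rightarrow> bool list pmf" where
  "bsc_list (p # ps) (x # xs) =
     do { f \<leftarrow> bernoulli_pmf p; ys \<leftarrow> bsc_list ps xs; return_pmf ((x \<noteq> f) # ys) }"
| "bsc_list _ _ = return_pmf []"

definition state_pmf :: "real \<Rightarrow> nat pmf" where
  "state_pmf q = map_pmf (\<lambda>b. if b then 1 else 2) (bernoulli_pmf q)"

definition xover :: "real \<Rightarrow> real \<Rightarrow> nat \<Rightarrow> real" where
  "xover a b s = (if s = 1 then a else b)"

text \<open>Joint distribution of (message M, states S = [(S_k, S*_k)], Y, Z) for a code
  with message set {..<Msz}, randomized encoder enc (independent of the states),
  block length N and B blocks.  Within block k (positions i with i div N = k)
  the main channel is BSC(p_{S_k}) and the eavesdropper channel BSC(p*_{S*_k}).\<close>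
definition joint ::
  "real \<Rightarrow> real \<Rightarrow> real \<Rightarrow> real \<Rightarrow> real \<Rightarrow> real \<Rightarrow> nat \<Rightarrow> nat \<Rightarrow> nat \<Rightarrow> (nat \<Rightarrow> bool list pmf)
    \<Rightarrow> (nat \<times> (nat \<times> nat) list \<times> bool list \<times> bool list) pmf" where
  "joint q1 q1s p1 p2 p1s p2s N B Msz enc = do {
     m \<leftarrow> pmf_of_set {..<Msz};
     x \<leftarrow> enc m;
     S \<leftarrow> iid_list B (pair_pmf (state_pmf q1) (state_pmf q1s));
     y \<leftarrow> bsc_list (map (\<lambda>i. xover p1 p2 (fst (S ! (i div N)))) [0..<N * B]) x;
     z \<leftarrow> bsc_list (map (\<lambda>i. xover p1s p2s (snd (S ! (i div N)))) [0..<N * B]) x;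
     return_pmf (m, S, y, z) }"

text \<open>Conditional mutual information I(A;B|C) (in bits) of a finitely supported joint pmf of (A,B,C).\<close>
definition cond_mi :: "('a \<times> 'b \<times> 'c) pmf \<Rightarrow> real" where
  "cond_mi d = (\<Sum>t\<in>set_pmf d. case t of (a, b, c) \<Rightarrow>
      pmf d (a, b, c) * log 2 (pmf d (a, b, c) * pmf (map_pmf (\<lambda>(a, b, c). c) d) c
        / (pmf (map_pmf (\<lambda>(a, b, c). (a, c)) d) (a, c) * pmf (map_pmf (\<lambda>(a, b, c). (b, c)) d) (b, c))))"

definition err_prob where
  "err_prob q1 q1s p1 p2 p1s p2s N B Msz enc dec =
     measure_pmf.prob (joint q1 q1s p1 p2 p1s p2s N B Msz enc) {(m, S, y, z). dec y S \<noteq> m}"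

definition leakage where
  "leakage q1 q1s p1 p2 p1s p2s N B Msz enc =
     cond_mi (map_pmf (\<lambda>(m, S, y, z). (m, z, S)) (joint q1 q1s p1 p2 p1s p2s N B Msz enc))"

definition valid_code :: "nat \<Rightarrow> nat \<Rightarrow> nat \<Rightarrow> (nat \<Rightarrow> bool list pmf) \<Rightarrow> bool" where
  "valid_code N B Msz enc \<longleftrightarrow> Msz \<ge> 1 \<and> (\<forall>m<Msz. \<forall>x\<in>set_pmf (enc m). length x = N * B)"

definition achievable :: "real \<Rightarrow> real \<Rightarrow> real \<Rightarrow> real \<Rightarrow> real \<Rightarrow> real \<Rightarrow> real \<Rightarrow> bool" where
  "achievable q1 q1s p1 p2 p1s p2s R \<longleftrightarrow>
     (\<exists>(N :: nat \<Rightarrow> nat) (B :: nat \<Rightarrow> nat) (Msz :: nat \<Rightarrow> nat)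
        (enc :: nat \<Rightarrow> nat \<Rightarrow> bool list pmf) (dec :: nat \<Rightarrow> bool list \<Rightarrow> (nat \<times> nat) list \<Rightarrow> nat).
        filterlim N at_top sequentially \<and> filterlim B at_top sequentially \<and>
        (\<forall>n. valid_code (N n) (B n) (Msz n) (enc n)) \<and>
        (\<forall>\<epsilon>>0. eventually (\<lambda>n. log 2 (real (Msz n)) / real (N n * B n) \<ge> R - \<epsilon>) sequentially) \<and>
        (\<lambda>n. err_prob q1 q1s p1 p2 p1s p2s (N n) (B n) (Msz n) (enc n) (dec n)) \<longlonglongrightarrow> 0 \<and>
        (\<lambda>n. leakage q1 q1s p1 p2 p1s p2s (N n) (B n) (Msz n) (enc n) / real (N n * B n)) \<longlonglongrightarrow> 0)"

definition Cs_CSI_D :: "real \<Rightarrow> real \<Rightarrow> real \<Rightarrow> real \<Rightarrow> real \<Rightarrow> real \<Rightarrow> ereal" where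
  "Cs_CSI_D q1 q1s p1 p2 p1s p2s = Sup (ereal ` {R. achievable q1 q1s p1 p2 p1s p2s R})"

end

theory Submission
  imports Defs
begin

text \<open>
  The claimed rate equals \<open>h\<^sup>* - h\<close>, where \<open>h\<close> and \<open>h\<^sup>*\<close> are the expected binary entropies of the
  main and of the eavesdropper's crossover probability; it is attained by random wiretap coding with
  uniform inputs. Draw codewords \<open>c(m, l)\<close> uniformly and pairwise independently, and send \<open>c(m, l)\<close>
  with \<open>l\<close> uniform in a set of size \<open>L \<approx> 2\<^bsup>n(1 - h\<^sup>* + \<epsilon>)\<^esup>\<close>. Threshold decoding of \<open>(m, l)\<close> succeeds as long
  as \<open>M L \<le> 2\<^bsup>n(1 - h - 2\<epsilon>)\<^esup>\<close>. For secrecy, \<open>I(M; Z | S)\<close> is at most the divergence of the law of \<open>Z\<close>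
  given \<open>(M, S)\<close> from the uniform law, whose mean over codebooks is bounded by
  \<open>E log (1 + 2\<^sup>n W(z | x) / L)\<close> (soft covering). Both bounds reduce to the concentration of the
  log-likelihood, which follows from Chebyshev's inequality for the channel noise given the states
  and for the states.
\<close>

section \<open>Finitely supported distributions and mutual information\<close>

lemma expectation_finite_pmf:
  fixes f :: "'a \<Rightarrow> real"
  assumes "finite A" "set_pmf p \<subseteq> A"
  shows "measure_pmf.expectation p f = (\<Sum>x\<in>A. pmf p x * f x)"
  using assms by (subst integral_measure_pmf_real[of A]) (auto simp: mult.commute)

lemma expectation_bind_finite:
  fixes h :: "'b \<Rightarrow> real"
  assumes "finite (set_pmf p)" "\<And>x. x \<in> set_pmf p \<Longrightarrow> finite (set_pmf (f x))"
  shows "measure_pmf.expectation (bind_pmf p f) h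
           = measure_pmf.expectation p (\<lambda>x. measure_pmf.expectation (f x) h)"
  using assms
  by (subst pmf_expectation_bind[of "set_pmf p"]) (auto simp: expectation_finite_pmf[of "set_pmf p"])

lemma expectation_mono_finite:
  fixes f g :: "'a \<Rightarrow> real"
  assumes "finite (set_pmf p)" "\<And>x. x \<in> set_pmf p \<Longrightarrow> f x \<le> g x"
  shows "measure_pmf.expectation p f \<le> measure_pmf.expectation p g"
  using assms by (simp add: expectation_finite_pmf[of "set_pmf p"] sum_mono mult_left_mono)

lemma expectation_swap_finite:
  fixes f :: "'a \<Rightarrow> 'b \<Rightarrow> real"
  assumes "finite (set_pmf p)" "finite (set_pmf q)"
  shows "measure_pmf.expectation p (\<lambda>x. measure_pmf.expectation q (f x))
       = measure_pmf.expectation q (\<lambda>y. measure_pmf.expectation p (\<lambda>x. f x y))"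
  using assms
  by (simp add: expectation_finite_pmf[of "set_pmf p"] expectation_finite_pmf[of "set_pmf q"]
      sum_distrib_left mult.left_commute) (rule sum.swap)

lemma expectation_pair_finite:
  fixes f :: "'a \<Rightarrow> 'b \<Rightarrow> real"
  assumes "finite (set_pmf p)" "finite (set_pmf q)"
  shows "measure_pmf.expectation (pair_pmf p q) (\<lambda>(x, y). f x y)
       = measure_pmf.expectation p (\<lambda>x. measure_pmf.expectation q (f x))"
  using assms unfolding pair_pmf_def
  by (simp add: expectation_bind_finite)

text \<open>If \<open>f\<close> exceeded \<open>a\<close> at every atom, so would its mean. This is
  how a good codebook is extracted from a random ensemble.\<close>

lemma expectation_le_imp_ex:
  fixes f :: "'a \<Rightarrow> real"
  assumes "finite (set_pmf p)" "measure_pmf.expectation p f \<le> a"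
  shows "\<exists>x\<in>set_pmf p. f x \<le> a"
proof (rule ccontr)
  assume "\<not> ?thesis"
  then have "(\<Sum>x\<in>set_pmf p. pmf p x * a) < (\<Sum>x\<in>set_pmf p. pmf p x * f x)"
    using assms by (intro sum_strict_mono) (auto simp: set_pmf_not_empty pmf_positive)
  moreover have "(\<Sum>x\<in>set_pmf p. pmf p x * a) = a"
    using assms by (simp add: sum_pmf_eq_1 flip: sum_distrib_right)
  ultimately show False
    using assms by (simp add: expectation_finite_pmf[of "set_pmf p"])
qed

text \<open>Chebyshev's inequality without centring: the indicator is dominated pointwise by
  \<open>(f x / t)\<^sup>2\<close>.\<close>

lemma markov_second_moment:
  fixes f :: "'a \<Rightarrow> real"
  assumes "finite (set_pmf p)" "0 < t"
  shows "measure_pmf.expectation p (\<lambda>x. of_bool (t \<le> \<bar>f x\<bar>))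
           \<le> measure_pmf.expectation p (\<lambda>x. (f x)\<^sup>2) / t\<^sup>2"
proof -
  have "of_bool (t \<le> \<bar>f x\<bar>) \<le> (f x)\<^sup>2 / t\<^sup>2" for x
    using assms(2) by (auto simp: abs_le_square_iff[symmetric])
  then have "measure_pmf.expectation p (\<lambda>x. of_bool (t \<le> \<bar>f x\<bar>))
      \<le> measure_pmf.expectation p (\<lambda>x. (f x)\<^sup>2 / t\<^sup>2)"
    using assms by (intro expectation_mono_finite) auto
  then show ?thesis by simp
qed

text \<open>The tangent of the concave logarithm at \<open>v\<close> lies above its graph. This
  linear bound takes the place of Jensen's inequality.\<close>

lemma log2_le: "0 < u \<Longrightarrow> 0 < v \<Longrightarrow> log 2 u \<le> log 2 v + (u / v - 1) / ln 2" for u v :: real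
proof -
  assume "0 < u" "0 < v"
  then have "ln (u / v) \<le> u / v - 1" by (intro ln_le_minus_one) simp
  then have "(ln u - ln v) / ln 2 \<le> (u / v - 1) / ln 2"
    using \<open>0 < u\<close> \<open>0 < v\<close> by (intro divide_right_mono) (auto simp: ln_div)
  then show ?thesis by (simp add: log_def diff_divide_distrib)
qed

section \<open>Conditional mutual information\<close>

lemma sum_pmf_fst:
  assumes "finite A" "fst ` set_pmf q \<subseteq> A"
  shows "(\<Sum>a\<in>A. pmf q (a, c)) = pmf (map_pmf snd q) c"
proof -
  have "pmf (map_pmf snd q) c = measure q (snd -` {c} \<inter> set_pmf q)"
    by (simp add: pmf_map measure_Int_set_pmf)
  also have "snd -` {c} \<inter> set_pmf q = (\<lambda>a. (a, c)) ` A \<inter> set_pmf q"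
    using assms(2) by force
  also have "measure q \<dots> = measure q ((\<lambda>a. (a, c)) ` A)"
    by (simp add: measure_Int_set_pmf)
  also have "\<dots> = (\<Sum>a\<in>A. pmf q (a, c))"
    using assms(1) by (subst measure_measure_pmf_finite) (auto simp: sum.reindex inj_on_def)
  finally show ?thesis ..
qed

text \<open>Gibbs' inequality: conditional mutual information is the divergence of \<open>d\<close>
  from the law with the same pair marginals under which the first two coordinates are conditionally
  independent given the third.\<close>

lemma cond_mi_nonneg:
  assumes fin: "finite (set_pmf d)"
  shows "0 \<le> cond_mi d"
proof -
  define ac bc dc where "ac = map_pmf (\<lambda>(a, b, c). (a, c)) d"
    and "bc = map_pmf (\<lambda>(a, b, c). (b, c)) d" and "dc = map_pmf (\<lambda>(a, b, c). c) d"
  define A B C where "A = fst ` set_pmf d" and "B = (fst \<circ> snd) ` set_pmf d"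
    and "C = (snd \<circ> snd) ` set_pmf d"
  \<comment> \<open>The mass function of that conditionally independent law.\<close>
  define r where "r = (\<lambda>(a, b, c). pmf ac (a, c) * pmf bc (b, c) / pmf dc c)"
  note defs = ac_def bc_def dc_def
  have fins: "finite A" "finite B" "finite C" using fin by (auto simp: A_def B_def C_def)
  have sub: "set_pmf d \<subseteq> A \<times> B \<times> C" by (force simp: A_def B_def C_def)
  have sac: "(\<Sum>a\<in>A. pmf ac (a, c)) = pmf dc c" for c
    using fins by (subst sum_pmf_fst; force simp: defs A_def map_pmf_comp case_prod_unfold)
  have sbc: "(\<Sum>b\<in>B. pmf bc (b, c)) = pmf dc c" for c
    using fins by (subst sum_pmf_fst; force simp: defs B_def map_pmf_comp case_prod_unfold)
  \<comment> \<open>Passing from the support to a product box lets the sum factor into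
    marginals.\<close>
  have "(\<Sum>t\<in>set_pmf d. r t) \<le> (\<Sum>t\<in>A \<times> B \<times> C. r t)"
    using sub fins by (intro sum_mono2) (auto simp: r_def)
  also have "\<dots> = (\<Sum>a\<in>A. \<Sum>b\<in>B. \<Sum>c\<in>C. pmf ac (a, c) * pmf bc (b, c) / pmf dc c)"
    by (simp add: r_def flip: sum.cartesian_product)
  also have "\<dots> = (\<Sum>c\<in>C. (\<Sum>a\<in>A. pmf ac (a, c)) * (\<Sum>b\<in>B. pmf bc (b, c)) / pmf dc c)"
    unfolding sum_product sum_divide_distrib
    by (subst sum.swap[where A = C and B = A], intro sum.cong refl sum.swap)
  \<comment> \<open>Where \<open>pmf dc c\<close> vanishes, both sides are 0, since division by 0
    yields 0.\<close>
  also have "\<dots> = (\<Sum>c\<in>C. pmf dc c)"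
    unfolding sac sbc by (intro sum.cong) auto
  also have "\<dots> = 1"
    using fins by (intro sum_pmf_eq_1; force simp: dc_def C_def)
  finally have r1: "(\<Sum>t\<in>set_pmf d. r t) \<le> 1" .
  have term_ge: "(pmf d t - r t) / ln 2 \<le> (case t of (a, b, c) \<Rightarrow>
      pmf d (a, b, c) * log 2 (pmf d (a, b, c) * pmf dc c / (pmf ac (a, c) * pmf bc (b, c))))"
    if t: "t \<in> set_pmf d" for t
  proof -
    obtain a b c where [simp]: "t = (a, b, c)" by (cases t)
    have pos: "0 < pmf d (a, b, c)" "0 < pmf ac (a, c)" "0 < pmf bc (b, c)" "0 < pmf dc c"
      using t by (force intro!: pmf_positive simp: defs)+
    have "- log 2 (pmf d t * pmf dc c / (pmf ac (a, c) * pmf bc (b, c)))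
        = log 2 (pmf ac (a, c) * pmf bc (b, c) / (pmf d t * pmf dc c))"
      using pos by (simp add: log_divide_pos log_mult_pos)
    also have "\<dots> \<le> (pmf ac (a, c) * pmf bc (b, c) / (pmf d t * pmf dc c) - 1) / ln 2"
      using log2_le[of "pmf ac (a, c) * pmf bc (b, c) / (pmf d t * pmf dc c)" 1] pos by simp
    finally have "pmf d t * - log 2 (pmf d t * pmf dc c / (pmf ac (a, c) * pmf bc (b, c)))
      \<le> pmf d t * ((pmf ac (a, c) * pmf bc (b, c) / (pmf d t * pmf dc c) - 1) / ln 2)"
      using pos by (intro mult_left_mono) auto
    also have "\<dots> = (r t - pmf d t) / ln 2"
      using pos by (simp add: r_def field_simps)
    finally show ?thesis by (simp add: field_simps)
  qed
  have "0 \<le> (1 - (\<Sum>t\<in>set_pmf d. r t)) / ln 2"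
    using r1 by simp
  also have "\<dots> = (\<Sum>t\<in>set_pmf d. (pmf d t - r t) / ln 2)"
    using fin by (simp add: sum_subtractf sum_pmf_eq_1 flip: sum_divide_distrib)
  also have "\<dots> \<le> cond_mi d"
    unfolding cond_mi_def defs[symmetric] by (intro sum_mono term_ge)
  finally show ?thesis .
qed

text \<open>The gap between the two sides is the divergence of the second coordinate, given the
  third, from the uniform law on \<open>B\<close>. Dropping this nonnegative term removes the output
  law averaged over messages, which is hard to control.\<close>

lemma cond_mi_le_aux:
  assumes fin: "finite (set_pmf d)" and finB: "finite B"
    and sub: "\<And>a b c. (a, b, c) \<in> set_pmf d \<Longrightarrow> b \<in> B"
  shows "cond_mi d \<le> measure_pmf.expectation d (\<lambda>(a, b, c).
           log 2 (card B * pmf d (a, b, c) / pmf (map_pmf (\<lambda>(a, b, c). (a, c)) d) (a, c)))"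
proof -
  define ac bc dc where "ac = map_pmf (\<lambda>(a, b, c). (a, c)) d"
    and "bc = map_pmf (\<lambda>(a, b, c). (b, c)) d" and "dc = map_pmf (\<lambda>(a, b, c). c) d"
  define C where "C = (snd \<circ> snd) ` set_pmf d"
  note defs = ac_def bc_def dc_def
  \<comment> \<open>The ratio of the uniform law on \<open>B\<close> to the conditional law of
    \<open>b\<close> given \<open>c\<close>; its mean is at most 1.\<close>
  define r where "r = (\<lambda>(b, c). pmf dc c / (card B * pmf bc (b, c)))"
  have finC: "finite C" using fin by (auto simp: C_def)
  have term_le: "(case t of (a, b, c) \<Rightarrow>
      pmf d (a, b, c) * log 2 (pmf d (a, b, c) * pmf dc c / (pmf ac (a, c) * pmf bc (b, c))))
      \<le> pmf d t * (case t of (a, b, c) \<Rightarrow> log 2 (card B * pmf d (a, b, c) / pmf ac (a, c)))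
        + pmf d t * ((r (snd t) - 1) / ln 2)"
    if t: "t \<in> set_pmf d" for t
  proof -
    obtain a b c where [simp]: "t = (a, b, c)" by (cases t)
    have "card B > 0" using sub t finB by (auto simp: card_gt_0_iff)
    then have pos: "0 < pmf d (a, b, c)" "0 < pmf ac (a, c)" "0 < pmf bc (b, c)" "0 < pmf dc c"
      "0 < real (card B)"
      using t by (force intro!: pmf_positive simp: defs)+
    \<comment> \<open>Tangent at the argument of the bounding logarithm: the quotient of the two
      arguments no longer involves \<open>a\<close> and equals \<open>r\<close>.\<close>
    have "log 2 (pmf d t * pmf dc c / (pmf ac (a, c) * pmf bc (b, c)))
      \<le> log 2 (card B * pmf d t / pmf ac (a, c)) +
         ((pmf d t * pmf dc c / (pmf ac (a, c) * pmf bc (b, c))) / (card B * pmf d t / pmf ac (a, c)) - 1) / ln 2"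
      using pos by (intro log2_le) auto
    also have "(pmf d t * pmf dc c / (pmf ac (a, c) * pmf bc (b, c))) / (card B * pmf d t / pmf ac (a, c))
         = r (snd t)"
      using pos by (simp add: r_def field_simps)
    finally have "pmf d t * log 2 (pmf d t * pmf dc c / (pmf ac (a, c) * pmf bc (b, c)))
      \<le> pmf d t * (log 2 (card B * pmf d t / pmf ac (a, c)) + (r (snd t) - 1) / ln 2)"
      by (rule mult_left_mono) simp
    then show ?thesis by (simp add: distrib_left)
  qed
  have "measure_pmf.expectation d (\<lambda>t. r (snd t)) = measure_pmf.expectation bc r"
    by (simp add: bc_def case_prod_unfold)
  also have "\<dots> = (\<Sum>t\<in>set_pmf bc. pmf bc t * r t)"
    using fin by (subst expectation_finite_pmf[of "set_pmf bc"]) (auto simp: bc_def)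
  also have "\<dots> = (\<Sum>(b, c)\<in>set_pmf bc. pmf dc c / card B)"
    by (intro sum.cong refl) (auto simp: r_def set_pmf_iff split: prod.splits)
  also have "\<dots> \<le> (\<Sum>(b, c)\<in>B \<times> C. pmf dc c / card B)"
    using sub finB finC by (intro sum_mono2) (force simp: bc_def C_def)+
  also have "\<dots> = card B * ((\<Sum>c\<in>C. pmf dc c) / card B)"
    by (simp add: sum_divide_distrib flip: sum.cartesian_product)
  also have "(\<Sum>c\<in>C. pmf dc c) = 1"
    using finC by (intro sum_pmf_eq_1; force simp: dc_def C_def)
  also have "card B * (1 / card B) \<le> (1::real)" by simp
  finally have r1: "(\<Sum>t\<in>set_pmf d. pmf d t * r (snd t)) \<le> 1"
    using fin by (simp add: expectation_finite_pmf[of "set_pmf d"])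
  have "(\<Sum>t\<in>set_pmf d. pmf d t * ((r (snd t) - 1) / ln 2))
      = ((\<Sum>t\<in>set_pmf d. pmf d t * r (snd t)) - 1) / ln 2"
    using fin by (simp add: sum_subtractf sum_pmf_eq_1 right_diff_distrib flip: sum_divide_distrib)
  also have "\<dots> \<le> 0" using r1 by (simp add: divide_nonpos_pos)
  finally have neg: "(\<Sum>t\<in>set_pmf d. pmf d t * ((r (snd t) - 1) / ln 2)) \<le> 0" .
  have "cond_mi d \<le> (\<Sum>t\<in>set_pmf d.
      pmf d t * (case t of (a, b, c) \<Rightarrow> log 2 (card B * pmf d (a, b, c) / pmf ac (a, c)))
        + pmf d t * ((r (snd t) - 1) / ln 2))"
    unfolding cond_mi_def defs[symmetric] by (intro sum_mono term_le)
  also have "\<dots> \<le> (\<Sum>t\<in>set_pmf d.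
      pmf d t * (case t of (a, b, c) \<Rightarrow> log 2 (card B * pmf d (a, b, c) / pmf ac (a, c))))"
    using neg by (simp add: sum.distrib)
  finally show ?thesis
    using fin by (simp add: expectation_finite_pmf[of "set_pmf d"] ac_def)
qed

text \<open>With \<open>A\<close> and \<open>C\<close> independent, the conditional law of
  \<open>b\<close> is the kernel \<open>K a c\<close> itself. It is applied to message, states and
  eavesdropper's word; message and states are independent because the encoder does not see the
  states.\<close>

lemma cond_mi_le:
  assumes fin: "finite (set_pmf A)" "finite (set_pmf C)" and finB: "finite B"
    and sub: "\<And>a c. a \<in> set_pmf A \<Longrightarrow> c \<in> set_pmf C \<Longrightarrow> set_pmf (K a c) \<subseteq> B"
    and d: "d = bind_pmf A (\<lambda>a. bind_pmf C (\<lambda>c. map_pmf (\<lambda>b. (a, b, c)) (K a c)))"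
  shows "cond_mi d \<le> measure_pmf.expectation A (\<lambda>a. measure_pmf.expectation C (\<lambda>c.
           measure_pmf.expectation (K a c) (\<lambda>b. log 2 (card B * pmf (K a c) b))))"
proof -
  have ac: "map_pmf (\<lambda>(a, b, c). (a, c)) d = pair_pmf A C"
    by (simp add: d pair_pmf_def map_bind_pmf map_pmf_comp map_pmf_def[of _ "K _ _"] bind_assoc_pmf
        bind_return_pmf)
  have finK: "finite (set_pmf (K a c))" if "a \<in> set_pmf A" "c \<in> set_pmf C" for a c
    using sub[OF that] finB by (rule finite_subset)
  have find: "finite (set_pmf d)"
    using fin finK by (auto simp: d)
  have pmf_d: "pmf d (a, b, c) = pmf A a * pmf C c * pmf (K a c) b" for a b c
  proof -
    \<comment> \<open>Only \<open>a' = a\<close> and \<open>c' = c\<close> can produce the triple.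
      Written with indicators, both integrals collapse to point masses.\<close>
    have 1: "pmf (map_pmf (\<lambda>b. (a', b, c')) (K a' c')) (a, b, c)
        = indicator {a} a' * (indicator {c} c' * pmf (K a c) b)" for a' c'
    proof (cases "a' = a \<and> c' = c")
      case True
      have "inj (\<lambda>b. (a, b, c))" by (simp add: inj_on_def)
      from pmf_map_inj'[OF this, of "K a c" b] True show ?thesis by simp
    next
      case False
      then have "pmf (map_pmf (\<lambda>b. (a', b, c')) (K a' c')) (a, b, c) = 0"
        by (auto simp: pmf_eq_0_set_pmf)
      with False show ?thesis by (auto simp: indicator_def)
    qed
    show ?thesis
      by (simp add: d pmf_bind 1 measure_pmf_single)
  qed
  have "cond_mi d \<le> measure_pmf.expectation d (\<lambda>(a, b, c).
           log 2 (card B * pmf d (a, b, c) / pmf (pair_pmf A C) (a, c)))"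
    using cond_mi_le_aux[OF find finB] sub unfolding ac by (force simp: d)
  also have "\<dots> = measure_pmf.expectation d (\<lambda>(a, b, c). log 2 (card B * pmf (K a c) b))"
  proof (intro integral_cong_AE)
    \<comment> \<open>The factors \<open>pmf A a\<close> and \<open>pmf C c\<close> cancel on the
      support, so equality is claimed only almost everywhere.\<close>
    have "pmf A a \<noteq> 0 \<and> pmf C c \<noteq> 0" if "(a, b, c) \<in> set_pmf d" for a b c
      using that by (auto simp: set_pmf_iff pmf_d)
    then show "AE t in measure_pmf d. (case t of (a, b, c) \<Rightarrow>
        log 2 (card B * pmf d (a, b, c) / pmf (pair_pmf A C) (a, c)))
      = (case t of (a, b, c) \<Rightarrow> log 2 (card B * pmf (K a c) b))"
      by (auto simp: AE_measure_pmf_iff pmf_d pmf_pair)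
  qed auto
  also have "\<dots> = measure_pmf.expectation A (\<lambda>a. measure_pmf.expectation C (\<lambda>c.
           measure_pmf.expectation (K a c) (\<lambda>b. log 2 (card B * pmf (K a c) b))))"
  proof -
    have "measure_pmf.expectation d f = measure_pmf.expectation A (\<lambda>a. measure_pmf.expectation C (\<lambda>c.
           measure_pmf.expectation (K a c) (\<lambda>b. f (a, b, c))))" for f :: "_ \<Rightarrow> real"
    proof -
      have "measure_pmf.expectation (bind_pmf C (\<lambda>c. map_pmf (\<lambda>b. (a, b, c)) (K a c))) f
          = measure_pmf.expectation C (\<lambda>c. measure_pmf.expectation (K a c) (\<lambda>b. f (a, b, c)))"
        if "a \<in> set_pmf A" for a
        using fin finK that by (subst expectation_bind_finite) auto
      then show ?thesis
        unfolding d using fin finK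
        by (subst expectation_bind_finite) (auto intro!: integral_cong_AE simp: AE_measure_pmf_iff)
    qed
    then show ?thesis by simp
  qed
  finally show ?thesis .
qed

section \<open>Random codes\<close>

lemma expectation_add_finite:
  fixes f g :: "'a \<Rightarrow> real"
  assumes "finite (set_pmf p)"
  shows "measure_pmf.expectation p (\<lambda>x. f x + g x)
       = measure_pmf.expectation p f + measure_pmf.expectation p g"
  using assms by (intro Bochner_Integration.integral_add integrable_measure_pmf_finite)

lemma expectation_sum_finite:
  fixes f :: "'b \<Rightarrow> 'a \<Rightarrow> real"
  assumes "finite (set_pmf p)"
  shows "measure_pmf.expectation p (\<lambda>x. \<Sum>i\<in>I. f i x) = (\<Sum>i\<in>I. measure_pmf.expectation p (f i))"
  using assms by (intro Bochner_Integration.integral_sum integrable_measure_pmf_finite)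

text \<open>Split off \<open>i\<close>; what remains is a product law with \<open>j\<close> among
  its components. Both ensemble averages rest on this pairwise independence of codewords.\<close>

lemma map_pmf_Pi_pmf_pair:
  assumes "finite I" "i \<in> I" "j \<in> I" "i \<noteq> j"
  shows "map_pmf (\<lambda>c. (c i, c j)) (Pi_pmf I dflt p) = pair_pmf (p i) (p j)"
proof -
  define J where "J = I - {i, j}"
  have I: "I = insert i (insert j J)" and J: "finite J" "i \<notin> J" "j \<notin> J"
    using assms by (auto simp: J_def)
  have "map_pmf (\<lambda>c. (c i, c j)) (Pi_pmf I dflt p)
      = pair_pmf (p i) (map_pmf (\<lambda>c. c j) (Pi_pmf (insert j J) dflt p))"
    unfolding I using J assms(4)
    by (subst Pi_pmf_insert) (auto simp: map_pmf_comp case_prod_unfold pair_map_pmf2 apsnd_def map_prod_def)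
  then show ?thesis
    using J by (simp add: Pi_pmf_component)
qed

lemma expectation_codeword:
  fixes f :: "'x \<Rightarrow> real"
  assumes "finite I" "i \<in> I"
  shows "measure_pmf.expectation (Pi_pmf I dflt p) (\<lambda>c. f (c i)) = measure_pmf.expectation (p i) f"
  using assms integral_map_pmf[of "\<lambda>c. c i" "Pi_pmf I dflt p" f] by (simp add: Pi_pmf_component)

lemma expectation_codeword_pair:
  fixes f :: "'x \<Rightarrow> 'x \<Rightarrow> real"
  assumes "finite I" "i \<in> I" "j \<in> I" "i \<noteq> j" "finite (set_pmf (p i))" "finite (set_pmf (p j))"
  shows "measure_pmf.expectation (Pi_pmf I dflt p) (\<lambda>c. f (c i) (c j))
       = measure_pmf.expectation (p i) (\<lambda>x. measure_pmf.expectation (p j) (f x))"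
  using assms integral_map_pmf[of "\<lambda>c. (c i, c j)" "Pi_pmf I dflt p" "\<lambda>(x, y). f x y"]
  by (simp add: map_pmf_Pi_pmf_pair expectation_pair_finite)

text \<open>\<open>X\<close> is both input and output alphabet, and \<open>W\<close> is doubly
  stochastic on it. Column sums equal to 1 give a uniform codeword the mean likelihood
  \<open>1 / card X\<close> at every output.\<close>

locale random_code =
  fixes X :: "'x set" and I :: "'i set" and dflt :: 'x and W :: "'x \<Rightarrow> 'x \<Rightarrow> real"
  assumes finX: "finite X" and X_ne: "X \<noteq> {}" and finI: "finite I"
    and W_nonneg: "0 \<le> W x y"
    and row_sum: "x \<in> X \<Longrightarrow> (\<Sum>y\<in>X. W x y) = 1"
    and col_sum: "y \<in> X \<Longrightarrow> (\<Sum>x\<in>X. W x y) = 1"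
begin

abbreviation "code \<equiv> Pi_pmf I dflt (\<lambda>_. pmf_of_set X)"

lemma fin_U: "finite (set_pmf (pmf_of_set X))"
  using finX X_ne by simp

lemma fin_code: "finite (set_pmf code)"
  using finX X_ne finI by (auto simp: set_Pi_pmf intro!: finite_PiE_dflt)

lemma card_X_pos: "0 < real (card X)"
  using finX X_ne by (simp add: card_gt_0_iff)

lemma expectation_W:
  "y \<in> X \<Longrightarrow> measure_pmf.expectation (pmf_of_set X) (\<lambda>x. W x y) = 1 / card X"
  using finX X_ne by (simp add: integral_pmf_of_set col_sum)

text \<open>Random coding bound for threshold decoding: either the sent word fails the test, or a
  wrong word passes it. A wrong word is independent of the output and its normalized likelihood
  \<open>card X * W (c j) y\<close> has mean 1, so by Markov's inequality it passes with probability
  at most \<open>1 / \<tau>\<close>; the union bound does the rest.\<close>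

lemma expectation_error:
  assumes i: "i \<in> I" and \<tau>: "0 < \<tau>"
  shows "measure_pmf.expectation code (\<lambda>c. \<Sum>y\<in>X. W (c i) y *
             (of_bool (card X * W (c i) y \<le> \<tau>) + (\<Sum>j\<in>I - {i}. of_bool (\<tau> < card X * W (c j) y))))
       \<le> measure_pmf.expectation (pmf_of_set X) (\<lambda>x. \<Sum>y\<in>X. W x y * of_bool (card X * W x y \<le> \<tau>))
           + card I / \<tau>"
proof -
  let ?E = "measure_pmf.expectation" and ?U = "pmf_of_set X"
  have pair: "?E code (\<lambda>c. \<Sum>y\<in>X. W (c i) y * of_bool (\<tau> < card X * W (c j) y)) \<le> 1 / \<tau>"
    if j: "j \<in> I - {i}" for j
  proof -
    have "?E code (\<lambda>c. \<Sum>y\<in>X. W (c i) y * of_bool (\<tau> < card X * W (c j) y))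
        = ?E ?U (\<lambda>x. ?E ?U (\<lambda>x'. \<Sum>y\<in>X. W x y * of_bool (\<tau> < card X * W x' y)))"
      using expectation_codeword_pair[OF finI i, of j "\<lambda>_. ?U" dflt
          "\<lambda>x x'. \<Sum>y\<in>X. W x y * of_bool (\<tau> < card X * W x' y)"] j fin_U by auto
    \<comment> \<open>Markov's inequality, pointwise: the indicator is at most the normalized
      likelihood divided by \<open>\<tau>\<close>.\<close>
    also have "\<dots> \<le> ?E ?U (\<lambda>x. ?E ?U (\<lambda>x'. \<Sum>y\<in>X. W x y * (card X / \<tau> * W x' y)))"
    proof (intro expectation_mono_finite fin_U sum_mono mult_left_mono W_nonneg)
      fix x' y
      show "of_bool (\<tau> < card X * W x' y) \<le> card X / \<tau> * W x' y"
        using \<tau> W_nonneg[of x' y] by (auto simp: field_simps)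
    qed
    also have "\<dots> = ?E ?U (\<lambda>x. \<Sum>y\<in>X. W x y * (card X / \<tau> * ?E ?U (\<lambda>x'. W x' y)))"
      using fin_U by (simp add: expectation_sum_finite)
    also have "\<dots> = ?E ?U (\<lambda>x. \<Sum>y\<in>X. W x y / \<tau>)"
      using card_X_pos by (intro Bochner_Integration.integral_cong sum.cong refl) (simp add: expectation_W)
    also have "\<dots> = ?E ?U (\<lambda>x. 1 / \<tau>)"
      using finX X_ne
      by (intro integral_cong_AE) (auto simp: AE_measure_pmf_iff row_sum simp flip: sum_divide_distrib)
    finally show ?thesis by simp
  qed
  have "?E code (\<lambda>c. \<Sum>y\<in>X. W (c i) y *
             (of_bool (card X * W (c i) y \<le> \<tau>) + (\<Sum>j\<in>I - {i}. of_bool (\<tau> < card X * W (c j) y))))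
     = ?E code (\<lambda>c. (\<Sum>y\<in>X. W (c i) y * of_bool (card X * W (c i) y \<le> \<tau>)) +
         (\<Sum>j\<in>I - {i}. \<Sum>y\<in>X. W (c i) y * of_bool (\<tau> < card X * W (c j) y)))"
    by (subst sum.swap) (simp add: distrib_left sum.distrib sum_distrib_left)
  also have "\<dots> = ?E ?U (\<lambda>x. \<Sum>y\<in>X. W x y * of_bool (card X * W x y \<le> \<tau>)) +
         (\<Sum>j\<in>I - {i}. ?E code (\<lambda>c. \<Sum>y\<in>X. W (c i) y * of_bool (\<tau> < card X * W (c j) y)))"
    unfolding expectation_add_finite[OF fin_code] expectation_sum_finite[OF fin_code]
    using expectation_codeword[OF finI i, of dflt "\<lambda>_. ?U"
        "\<lambda>x. \<Sum>y\<in>X. W x y * of_bool (card X * W x y \<le> \<tau>)"]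
    by (simp only: expectation_sum_finite[OF fin_code] expectation_sum_finite[OF fin_U])
  also have "(\<Sum>j\<in>I - {i}. ?E code (\<lambda>c. \<Sum>y\<in>X. W (c i) y * of_bool (\<tau> < card X * W (c j) y)))
      \<le> (\<Sum>j\<in>I - {i}. 1 / \<tau>)"
    by (intro sum_mono pair)
  also have "(\<Sum>j\<in>I - {i}. 1 / \<tau>) \<le> card I / \<tau>"
    using \<tau> finI by (simp add: divide_right_mono card_mono)
  finally show ?thesis by simp
qed

text \<open>Soft covering. Given the codeword \<open>c i\<close>, every other codeword of
  \<open>J\<close> has normalized likelihood of mean 1, so the normalized mixture has conditional
  mean at most \<open>1 + card X * W / card J\<close>. The tangent of the logarithm at that value
  makes the bound linear in the other codewords, so that pairs can be averaged one at a
  time.\<close>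

lemma expectation_divergence:
  assumes J: "J \<subseteq> I" "i \<in> J"
  shows "measure_pmf.expectation code (\<lambda>c. \<Sum>z\<in>X. W (c i) z *
             log 2 (card X / card J * (\<Sum>j\<in>J. W (c j) z)))
       \<le> measure_pmf.expectation (pmf_of_set X) (\<lambda>x. \<Sum>z\<in>X. W x z *
             log 2 (1 + card X * W x z / card J))"
proof -
  let ?E = "measure_pmf.expectation" and ?U = "pmf_of_set X"
  define L where "L = real (card J)"
  have finJ: "finite J" and i: "i \<in> I" using J finI finite_subset by auto
  have L: "L \<ge> 1" using J finJ by (auto simp: L_def Suc_le_eq card_gt_0_iff)
  \<comment> \<open>The point of tangency. The exact conditional mean has \<open>(L - 1) / L\<close>
    in place of 1; rounding up ensures \<open>v \<ge> 1\<close>.\<close>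
  define v where "v x z = 1 + card X * W x z / L" for x z
  have v: "v x z \<ge> 1" for x z using W_nonneg[of x z] L by (simp add: v_def)
  have vpos: "v x z > 0" for x z using v[of x z] by linarith
  \<comment> \<open>The linear term splits into the share \<open>a\<close> of the sent codeword and
    the shares \<open>b\<close> of the other codewords.\<close>
  define a where "a x z = card X / L * (W x z * W x z / v x z)" for x z
  define b where "b x x' z = card X / L * (W x z * W x' z / v x z)" for x x' z
  have pointwise: "W (c i) z * log 2 (card X / L * (\<Sum>j\<in>J. W (c j) z))
      \<le> W (c i) z * log 2 (v (c i) z) +
         (a (c i) z + (\<Sum>j\<in>J - {i}. b (c i) (c j) z) - W (c i) z) / ln 2" for c z
  proof (cases "W (c i) z = 0")
    case False
    then have pos: "W (c i) z > 0" using W_nonneg[of "c i" z] by simp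
    have sum: "(\<Sum>j\<in>J. W (c j) z) = W (c i) z + (\<Sum>j\<in>J - {i}. W (c j) z)"
      using J finJ by (simp add: sum.remove)
    then have "(\<Sum>j\<in>J. W (c j) z) > 0"
      using pos by (simp add: add_pos_nonneg sum_nonneg W_nonneg)
    then have u: "card X / L * (\<Sum>j\<in>J. W (c j) z) > 0"
      using card_X_pos L by simp
    have "W (c i) z * log 2 (card X / L * (\<Sum>j\<in>J. W (c j) z)) \<le> W (c i) z *
       (log 2 (v (c i) z) + (card X / L * (\<Sum>j\<in>J. W (c j) z) / v (c i) z - 1) / ln 2)"
      using pos by (intro mult_left_mono log2_le[OF u vpos]) auto
    also have "\<dots> = W (c i) z * log 2 (v (c i) z) +
       (W (c i) z * (card X / L * (\<Sum>j\<in>J. W (c j) z) / v (c i) z) - W (c i) z) / ln 2"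
      by (simp add: algebra_simps diff_divide_distrib)
    also have "W (c i) z * (card X / L * (\<Sum>j\<in>J. W (c j) z) / v (c i) z)
        = a (c i) z + (\<Sum>j\<in>J - {i}. b (c i) (c j) z)"
      unfolding sum a_def b_def
      by (simp add: sum_distrib_left sum_divide_distrib distrib_left add_divide_distrib mult_ac)
    finally show ?thesis .
  qed (simp add: a_def b_def)
  have Eb: "?E code (\<lambda>c. \<Sum>z\<in>X. b (c i) (c j) z) = ?E ?U (\<lambda>x. \<Sum>z\<in>X. W x z / v x z / L)"
    if j: "j \<in> J - {i}" for j
  proof -
    have "?E code (\<lambda>c. \<Sum>z\<in>X. b (c i) (c j) z)
        = ?E ?U (\<lambda>x. ?E ?U (\<lambda>x'. \<Sum>z\<in>X. b x x' z))"
      using expectation_codeword_pair[OF finI i, of j "\<lambda>_. ?U" dflt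
          "\<lambda>x x'. \<Sum>z\<in>X. b x x' z"] j J fin_U by auto
    also have "\<dots> = ?E ?U (\<lambda>x. \<Sum>z\<in>X. card X / L * (W x z * ?E ?U (\<lambda>x'. W x' z) / v x z))"
      using fin_U by (simp add: expectation_sum_finite b_def)
    also have "\<dots> = ?E ?U (\<lambda>x. \<Sum>z\<in>X. W x z / v x z / L)"
      using card_X_pos by (intro Bochner_Integration.integral_cong sum.cong refl) (simp add: expectation_W)
    finally show ?thesis .
  qed
  \<comment> \<open>On average the linear terms do not exceed the mass of \<open>W\<close> that the
    tangent subtracts, so only the logarithm of \<open>v\<close> survives.\<close>
  have "?E ?U (\<lambda>x. \<Sum>z\<in>X. a x z) + (\<Sum>j\<in>J - {i}. ?E ?U (\<lambda>x. \<Sum>z\<in>X. W x z / v x z / L))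
      = ?E ?U (\<lambda>x. \<Sum>z\<in>X. a x z + (L - 1) / L * (W x z / v x z))"
  proof -
    have "(\<Sum>j\<in>J - {i}. ?E ?U (\<lambda>x. \<Sum>z\<in>X. W x z / v x z / L))
        = ?E ?U (\<lambda>x. (L - 1) * (\<Sum>z\<in>X. W x z / v x z / L))"
      using J finJ L by (subst integral_mult_right_zero) (simp add: L_def)
    then show ?thesis
      by (simp add: sum.distrib sum_distrib_left mult_ac flip: expectation_add_finite[OF fin_U])
  qed
  also have "\<dots> \<le> ?E ?U (\<lambda>x. \<Sum>z\<in>X. W x z)"
  proof (intro expectation_mono_finite fin_U sum_mono)
    fix x z
    \<comment> \<open>The sent codeword supplies \<open>card X / L * W x z\<close> and the others
      together \<open>(L - 1) / L\<close>; the sum is at most \<open>v x z\<close>.\<close>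
    have "a x z + (L - 1) / L * (W x z / v x z) = W x z / v x z * (card X / L * W x z + (L - 1) / L)"
      by (simp add: a_def algebra_simps)
    also have "\<dots> \<le> W x z / v x z * v x z"
      using L vpos[of x z] W_nonneg[of x z] by (intro mult_left_mono) (auto simp: v_def)
    finally show "a x z + (L - 1) / L * (W x z / v x z) \<le> W x z"
      using vpos[of x z] by simp
  qed
  finally have le0: "?E ?U (\<lambda>x. \<Sum>z\<in>X. a x z)
      + (\<Sum>j\<in>J - {i}. ?E code (\<lambda>c. \<Sum>z\<in>X. b (c i) (c j) z)) - ?E ?U (\<lambda>x. \<Sum>z\<in>X. W x z) \<le> 0"
    by (simp add: Eb)
  have cw: "?E code (\<lambda>c. \<Sum>z\<in>X. f (c i) z) = ?E ?U (\<lambda>x. \<Sum>z\<in>X. f x z)" for f :: "'x \<Rightarrow> 'x \<Rightarrow> real"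
    using expectation_codeword[OF finI i, of dflt "\<lambda>_. ?U" "\<lambda>x. \<Sum>z\<in>X. f x z"] by simp
  have "?E code (\<lambda>c. \<Sum>z\<in>X. W (c i) z * log 2 (card X / L * (\<Sum>j\<in>J. W (c j) z)))
     \<le> ?E code (\<lambda>c. \<Sum>z\<in>X. W (c i) z * log 2 (v (c i) z) +
         (a (c i) z + (\<Sum>j\<in>J - {i}. b (c i) (c j) z) - W (c i) z) / ln 2)"
    by (intro expectation_mono_finite fin_code sum_mono pointwise)
  also have "\<dots> = ?E code (\<lambda>c. (\<Sum>z\<in>X. W (c i) z * log 2 (v (c i) z)) +
         ((\<Sum>z\<in>X. a (c i) z) + (\<Sum>j\<in>J - {i}. \<Sum>z\<in>X. b (c i) (c j) z) + (- 1) * (\<Sum>z\<in>X. W (c i) z)) / ln 2)"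
    by (subst sum.swap) (simp add: sum.distrib sum_subtractf flip: sum_divide_distrib)
  also have "\<dots> = ?E code (\<lambda>c. \<Sum>z\<in>X. W (c i) z * log 2 (v (c i) z)) +
         (?E code (\<lambda>c. \<Sum>z\<in>X. a (c i) z) + (\<Sum>j\<in>J - {i}. ?E code (\<lambda>c. \<Sum>z\<in>X. b (c i) (c j) z))
          + (- 1) * ?E code (\<lambda>c. \<Sum>z\<in>X. W (c i) z)) / ln 2"
    by (subst expectation_add_finite[OF fin_code], subst integral_divide_zero,
        subst expectation_add_finite[OF fin_code], subst expectation_add_finite[OF fin_code],
        subst expectation_sum_finite[OF fin_code], subst integral_mult_right_zero) (rule refl)
  also have "\<dots> \<le> ?E ?U (\<lambda>x. \<Sum>z\<in>X. W x z * log 2 (v x z))"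
    using le0 cw[of a] cw[of W] cw[of "\<lambda>x z. W x z * log 2 (v x z)"] by (simp add: divide_nonpos_pos)
  finally show ?thesis by (simp add: L_def v_def)
qed

end

section \<open>Concentration of the log-likelihood\<close>

lemma bsc_list_Cons:
  "bsc_list (p # ps) (x # xs)
     = map_pmf (\<lambda>(f, ys). (x \<noteq> f) # ys) (pair_pmf (bernoulli_pmf p) (bsc_list ps xs))"
  by (simp add: pair_pmf_def map_bind_pmf map_return_pmf)

lemma set_pmf_bsc_list:
  "length ps = length x \<Longrightarrow> set_pmf (bsc_list ps x) \<subseteq> {y. length y = length x}"
  by (induction ps x rule: list_induct2) (auto simp del: bsc_list.simps(1) simp: bsc_list_Cons)

lemma finite_words: "finite {y :: bool list. length y = n}"
  using finite_lists_length_eq[of "UNIV :: bool set" n] by simp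

lemma card_words: "card {y :: bool list. length y = n} = 2 ^ n"
  using card_lists_length_eq[of "UNIV :: bool set" n] by simp

lemma finite_set_pmf_bsc_list: "finite (set_pmf (bsc_list ps x))"
  by (induction ps x rule: bsc_list.induct) auto

lemma pmf_bsc_list_Cons:
  assumes "0 \<le> p" "p \<le> 1"
  shows "pmf (bsc_list (p # ps) (x # xs)) (y # ys) = (if x = y then 1 - p else p) * pmf (bsc_list ps xs) ys"
proof -
  have "inj (\<lambda>(f, ys). (x \<noteq> f) # ys)" by (auto simp: inj_on_def)
  \<comment> \<open>The only noise bit carrying \<open>x\<close> to \<open>y\<close> is
    \<open>x \<noteq> y\<close>.\<close>
  from pmf_map_inj'[OF this, of _ "(x \<noteq> y, ys)"]
  have "pmf (bsc_list (p # ps) (x # xs)) ((x \<noteq> (x \<noteq> y)) # ys)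
      = pmf (bernoulli_pmf p) (x \<noteq> y) * pmf (bsc_list ps xs) ys"
    unfolding bsc_list_Cons by (simp add: pmf_pair)
  moreover have "(x \<noteq> (x \<noteq> y)) = y" by auto
  ultimately show ?thesis using assms by auto
qed

text \<open>The likelihood depends only on the positions where the words differ. This symmetry turns
  row sums into column sums.\<close>

lemma pmf_bsc_list_commute:
  assumes "length ps = length x" "length x = length y" "\<forall>p\<in>set ps. 0 \<le> p \<and> p \<le> 1"
  shows "pmf (bsc_list ps x) y = pmf (bsc_list ps y) x"
  using assms
  by (induction ps x y rule: list_induct3) (auto simp: pmf_bsc_list_Cons simp del: bsc_list.simps(1))

section \<open>Moments of sums of independent centred terms\<close>

lemma finite_set_pmf_iid_list: "finite (set_pmf d) \<Longrightarrow> finite (set_pmf (iid_list n d))"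
  by (induction n) auto

lemma set_pmf_iid_list: "s \<in> set_pmf (iid_list n d) \<Longrightarrow> length s = n \<and> set s \<subseteq> set_pmf d"
  by (induction n arbitrary: s) (auto, blast)

text \<open>The cross term factors into a product of two zero means, so second moments add.\<close>

lemma expectation_add_independent:
  fixes f :: "'a \<Rightarrow> real" and F :: "'b \<Rightarrow> real"
  assumes "finite (set_pmf p)" "finite (set_pmf q)"
    and "measure_pmf.expectation p f = 0" "measure_pmf.expectation q F = 0"
  shows "measure_pmf.expectation (pair_pmf p q) (\<lambda>(x, y). f x + F y) = 0"
    and "measure_pmf.expectation (pair_pmf p q) (\<lambda>(x, y). (f x + F y)\<^sup>2)
       = measure_pmf.expectation p (\<lambda>x. (f x)\<^sup>2) + measure_pmf.expectation q (\<lambda>y. (F y)\<^sup>2)"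
  using assms
  by (simp_all add: expectation_pair_finite power2_sum integrable_measure_pmf_finite)

lemma iid_list_moments:
  fixes g :: "'a \<Rightarrow> real"
  assumes "finite (set_pmf d)" "measure_pmf.expectation d g = 0"
  shows "measure_pmf.expectation (iid_list n d) (\<lambda>s. sum_list (map g s)) = 0
       \<and> measure_pmf.expectation (iid_list n d) (\<lambda>s. (sum_list (map g s))\<^sup>2)
           = n * measure_pmf.expectation d (\<lambda>x. (g x)\<^sup>2)"
proof (induction n)
  case (Suc n)
  have eq: "iid_list (Suc n) d = map_pmf (\<lambda>(x, xs). x # xs) (pair_pmf d (iid_list n d))"
    by (simp add: pair_pmf_def map_bind_pmf map_return_pmf)
  note ind = expectation_add_independent[OF assms(1) finite_set_pmf_iid_list[OF assms(1)] assms(2)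
      conjunct1[OF Suc]]
  show ?case
    using ind Suc unfolding eq by (simp add: case_prod_unfold algebra_simps)
qed simp

text \<open>The centred log-likelihood, defined symbol by symbol so that it is additive even where
  the likelihood vanishes; with \<open>log 2 0 = 0\<close> the logarithm of the product is
  not.\<close>

fun bsc_dev :: "real list \<Rightarrow> bool list \<Rightarrow> bool list \<Rightarrow> real" where
  "bsc_dev (p # ps) (x # xs) (y # ys)
     = log 2 (if x = y then 1 - p else p) + Hb p + bsc_dev ps xs ys"
| "bsc_dev _ _ _ = 0"

text \<open>A nonzero likelihood has only positive factors, so its logarithm splits into a
  sum.\<close>

lemma bsc_dev_eq:
  assumes "length ps = length x" "length x = length y" "\<forall>p\<in>set ps. 0 \<le> p \<and> p \<le> 1"
    and "pmf (bsc_list ps x) y \<noteq> 0"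
  shows "bsc_dev ps x y = log 2 (pmf (bsc_list ps x) y) + sum_list (map Hb ps)"
  using assms
proof (induction ps x y rule: list_induct3)
  case (Cons p ps x xs y ys)
  then have "(if x = y then 1 - p else p) > 0" "pmf (bsc_list ps xs) ys > 0"
    by (auto simp: pmf_bsc_list_Cons order.strict_iff_order simp del: bsc_list.simps(1) split: if_splits)
  then show ?case
    using Cons by (simp add: pmf_bsc_list_Cons log_mult_pos del: bsc_list.simps(1) split del: if_split)
qed simp

text \<open>The variance of the log-likelihood of one channel use (the varentropy of the noise
  bit).\<close>

definition log_var :: "real \<Rightarrow> real" where
  "log_var p = (1 - p) * (log 2 (1 - p) + Hb p)\<^sup>2 + p * (log 2 p + Hb p)\<^sup>2"

lemma bsc_dev_moments:
  assumes "length ps = length x" "\<forall>p\<in>set ps. 0 \<le> p \<and> p \<le> 1"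
  shows "measure_pmf.expectation (bsc_list ps x) (bsc_dev ps x) = 0
       \<and> measure_pmf.expectation (bsc_list ps x) (\<lambda>y. (bsc_dev ps x y)\<^sup>2) = sum_list (map log_var ps)"
  using assms
proof (induction ps x rule: list_induct2)
  case (Cons p ps x xs)
  \<comment> \<open>As a function of the noise bit \<open>f\<close> alone, the deviation has a law
    that is independent of the input word.\<close>
  define l where "l f = log 2 (if f then p else 1 - p) + Hb p" for f
  have p: "0 \<le> p" "p \<le> 1" using Cons.prems by auto
  have l0: "measure_pmf.expectation (bernoulli_pmf p) l = 0"
    using p by (simp add: l_def Hb_def algebra_simps)
  have l2: "measure_pmf.expectation (bernoulli_pmf p) (\<lambda>f. (l f)\<^sup>2) = log_var p"
    using p by (simp add: l_def log_var_def algebra_simps)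
  have dev: "bsc_dev (p # ps) (x # xs) ((x = (\<not> f)) # ys) = l f + bsc_dev ps xs ys" for f ys
    by (auto simp: l_def)
  have IH0: "measure_pmf.expectation (bsc_list ps xs) (bsc_dev ps xs) = 0"
    and IH2: "measure_pmf.expectation (bsc_list ps xs) (\<lambda>y. (bsc_dev ps xs y)\<^sup>2) = sum_list (map log_var ps)"
    using Cons by auto
  have fin: "finite (set_pmf (bernoulli_pmf p))" by (rule finite_subset[of _ UNIV]) auto
  note ind = expectation_add_independent[OF fin finite_set_pmf_bsc_list l0 IH0]
  show ?case
    using ind l2 IH2 unfolding bsc_list_Cons
    by (simp add: case_prod_unfold dev del: bsc_dev.simps)
qed simp

section \<open>Block fading and the joint fluctuation of noise and states\<close>

definition block_xover :: "real \<Rightarrow> real \<Rightarrow> ('s \<Rightarrow> nat) \<Rightarrow> nat \<Rightarrow> nat \<Rightarrow> 's list \<Rightarrow> real list" where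
  "block_xover pa pb \<pi> N B S = map (\<lambda>i. xover pa pb (\<pi> (S ! (i div N)))) [0..<N * B]"

lemma length_block_xover [simp]: "length (block_xover pa pb \<pi> N B S) = N * B"
  by (simp add: block_xover_def)

lemma set_block_xover: "set (block_xover pa pb \<pi> N B S) \<subseteq> {pa, pb}"
  by (auto simp: block_xover_def xover_def)

lemma sum_list_block_xover:
  fixes f :: "real \<Rightarrow> real"
  assumes "length S = B"
  shows "sum_list (map f (block_xover pa pb \<pi> N B S)) = N * sum_list (map (\<lambda>s. f (xover pa pb (\<pi> s))) S)"
proof (cases "N = 0")
  case False
  have "sum_list (map f (block_xover pa pb \<pi> N B S)) = (\<Sum>i<B * N. f (xover pa pb (\<pi> (S ! (i div N)))))"
    by (simp add: block_xover_def interv_sum_list_conv_sum_set_nat atLeast0LessThan mult.commute o_def)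
  \<comment> \<open>Symbols are regrouped by block; \<open>i div N\<close> is the block
    index.\<close>
  also have "\<dots> = (\<Sum>k<B. \<Sum>i=k * N..<k * N + N. f (xover pa pb (\<pi> (S ! (i div N)))))"
    by (rule sum.nat_group[symmetric])
  also have "\<dots> = (\<Sum>k<B. \<Sum>i=k * N..<k * N + N. f (xover pa pb (\<pi> (S ! k))))"
  proof (intro sum.cong refl)
    fix k i assume "i \<in> {k * N..<k * N + N}"
    then have "i div N = k" by (intro div_nat_eqI) (auto simp: mult.commute)
    then show "f (xover pa pb (\<pi> (S ! (i div N)))) = f (xover pa pb (\<pi> (S ! k)))" by simp
  qed
  also have "\<dots> = N * (\<Sum>k<B. f (xover pa pb (\<pi> (S ! k))))"
    by (simp add: sum_distrib_left)
  finally show ?thesis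
    using assms by (simp add: sum_list_sum_nth atLeast0LessThan)
qed (simp add: block_xover_def)

text \<open>The deviation is channel noise given the states minus \<open>N\<close> times the centred
  sum of block entropies. The noise has variance of order \<open>N * B\<close>; the state term has
  variance of order \<open>N\<^sup>2 * B\<close>, because a state persists for a whole block. Hence
  the last summand decays only in \<open>B\<close>, and many blocks are required.\<close>

lemma log_likelihood_deviation:
  fixes \<pi> :: "'s \<Rightarrow> nat" and pa pb :: real
  defines "g \<equiv> \<lambda>s. Hb (xover pa pb (\<pi> s))"
  assumes d: "finite (set_pmf d)" and h: "h = measure_pmf.expectation d g"
    and p: "0 \<le> pa" "pa \<le> 1" "0 \<le> pb" "pb \<le> 1" and x: "length x = N * B"
    and pos: "0 < N" "0 < B" "0 < \<epsilon>"
  shows "measure_pmf.expectation (iid_list B d) (\<lambda>S.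
           measure_pmf.expectation (bsc_list (block_xover pa pb \<pi> N B S) x) (\<lambda>y.
             of_bool (\<epsilon> * (real N * real B) \<le> \<bar>log 2 (pmf (bsc_list (block_xover pa pb \<pi> N B S) x) y) + real N * real B * h\<bar>)))
       \<le> 2 * (log_var pa + log_var pb) / (\<epsilon>\<^sup>2 * (real N * real B))
         + 2 * measure_pmf.expectation d (\<lambda>s. (g s - h)\<^sup>2) / (\<epsilon>\<^sup>2 * B)"
proof -
  let ?E = "measure_pmf.expectation" and ?n = "real N * real B"
  let ?bsc = "\<lambda>S. bsc_list (block_xover pa pb \<pi> N B S) x"
  have finS: "finite (set_pmf (iid_list B d))" by (rule finite_set_pmf_iid_list[OF d])
  have finb: "finite (set_pmf (?bsc S))" for S
    by (rule finite_set_pmf_bsc_list)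
  have pset: "\<forall>p\<in>set (block_xover pa pb \<pi> N B S). 0 \<le> p \<and> p \<le> 1" for S
    using set_block_xover[of pa pb \<pi> N B S] p by auto
  \<comment> \<open>Bounds the variance of a symbol in either state.\<close>
  define V where "V = log_var pa + log_var pb"
  have lv: "0 \<le> log_var pa" "0 \<le> log_var pb" using p by (auto simp: log_var_def)
  have inner: "?E (?bsc S) (\<lambda>y. of_bool (\<epsilon> * ?n \<le> \<bar>log 2 (pmf (?bsc S) y) + ?n * h\<bar>))
      \<le> (2 * (?n * V) + 2 * (N * sum_list (map (\<lambda>s. g s - h) S))\<^sup>2) / (\<epsilon> * ?n)\<^sup>2"
    if S: "S \<in> set_pmf (iid_list B d)" for S
  proof -
    let ?ps = "block_xover pa pb \<pi> N B S"
    have len: "length S = B" using set_pmf_iid_list[OF S] by simp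
    have sumH: "sum_list (map Hb ?ps) = N * sum_list (map (\<lambda>s. g s - h) S) + ?n * h"
      unfolding sum_list_block_xover[OF len] g_def using len
      by (simp add: sum_list_subtractf sum_list_triv algebra_simps)
    have "sum_list (map log_var ?ps) \<le> sum_list (map (\<lambda>_. V) ?ps)"
      using set_block_xover[of pa pb \<pi> N B S] lv by (intro sum_list_mono) (auto simp: V_def)
    then have sumV: "sum_list (map log_var ?ps) \<le> ?n * V" by (simp add: sum_list_triv)
    have "?E (?bsc S) (\<lambda>y. of_bool (\<epsilon> * ?n \<le> \<bar>log 2 (pmf (?bsc S) y) + ?n * h\<bar>))
       \<le> ?E (?bsc S) (\<lambda>y. (log 2 (pmf (?bsc S) y) + ?n * h)\<^sup>2) / (\<epsilon> * ?n)\<^sup>2"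
      using pos by (intro markov_second_moment finb) auto
    also have "?E (?bsc S) (\<lambda>y. (log 2 (pmf (?bsc S) y) + ?n * h)\<^sup>2)
       \<le> ?E (?bsc S) (\<lambda>y. 2 * (bsc_dev ?ps x y)\<^sup>2 + 2 * (N * sum_list (map (\<lambda>s. g s - h) S))\<^sup>2)"
    proof (intro expectation_mono_finite finb)
      fix y assume y: "y \<in> set_pmf (?bsc S)"
      then have "length y = length x" using set_pmf_bsc_list[of ?ps x] x by auto
      then have "bsc_dev ?ps x y = log 2 (pmf (?bsc S) y) + sum_list (map Hb ?ps)"
        using x pset y by (intro bsc_dev_eq) (auto simp: set_pmf_iff)
      then have "log 2 (pmf (?bsc S) y) + ?n * h = bsc_dev ?ps x y - N * sum_list (map (\<lambda>s. g s - h) S)"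
        using sumH by simp
      \<comment> \<open>For real s and t, (s - t)^2 is at most 2 s^2 + 2 t^2, because (s + t)^2 is
        nonnegative.\<close>
      also have "\<dots>\<^sup>2 \<le> 2 * (bsc_dev ?ps x y)\<^sup>2 + 2 * (N * sum_list (map (\<lambda>s. g s - h) S))\<^sup>2"
        using zero_le_power2[of "bsc_dev ?ps x y + N * sum_list (map (\<lambda>s. g s - h) S)"]
        by (simp only: power2_sum power2_diff)
      finally show "(log 2 (pmf (?bsc S) y) + ?n * h)\<^sup>2 \<le> \<dots>" .
    qed
    also have "\<dots> \<le> 2 * (?n * V) + 2 * (N * sum_list (map (\<lambda>s. g s - h) S))\<^sup>2"
      using bsc_dev_moments[OF _ pset[of S], of x] sumV x
      by (simp add: integrable_measure_pmf_finite[OF finb])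
    finally show ?thesis by (simp add: divide_right_mono)
  qed
  have Eg0: "?E d (\<lambda>s. g s - h) = 0"
    using d by (simp add: h integrable_measure_pmf_finite)
  have "?E (iid_list B d) (\<lambda>S.
        ?E (?bsc S) (\<lambda>y. of_bool (\<epsilon> * ?n \<le> \<bar>log 2 (pmf (?bsc S) y) + ?n * h\<bar>)))
     \<le> ?E (iid_list B d) (\<lambda>S. (2 * (?n * V) + 2 * (N * sum_list (map (\<lambda>s. g s - h) S))\<^sup>2) / (\<epsilon> * ?n)\<^sup>2)"
    by (intro expectation_mono_finite finS inner)
  also have "\<dots> = (2 * (?n * V) + 2 * (real N ^ 2 * (B * ?E d (\<lambda>s. (g s - h)\<^sup>2)))) / (\<epsilon> * ?n)\<^sup>2"
    using iid_list_moments[OF d Eg0, of B]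
    by (simp add: integrable_measure_pmf_finite[OF finS] power_mult_distrib)
  also have "\<dots> = 2 * V / (\<epsilon>\<^sup>2 * ?n) + 2 * ?E d (\<lambda>s. (g s - h)\<^sup>2) / (\<epsilon>\<^sup>2 * B)"
    using pos by (simp add: field_simps power2_eq_square)
  finally show ?thesis by (simp add: V_def)
qed

section \<open>Random wiretap codes\<close>

lemma pmf_bsc_list_doubly_stochastic:
  assumes "length ps = n" "\<forall>p\<in>set ps. 0 \<le> p \<and> p \<le> 1"
  shows "length x = n \<Longrightarrow> (\<Sum>y | length y = n. pmf (bsc_list ps x) y) = 1"
    and "length y = n \<Longrightarrow> (\<Sum>x | length x = n. pmf (bsc_list ps x) y) = 1"
proof -
  show row: "(\<Sum>y | length y = n. pmf (bsc_list ps x) y) = 1" if "length x = n" for x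
    using that assms set_pmf_bsc_list[of ps x] by (intro sum_pmf_eq_1 finite_words) auto
  show "(\<Sum>x | length x = n. pmf (bsc_list ps x) y) = 1" if y: "length y = n"
  proof -
    have "(\<Sum>x | length x = n. pmf (bsc_list ps x) y) = (\<Sum>x | length x = n. pmf (bsc_list ps y) x)"
      using assms y by (intro sum.cong refl pmf_bsc_list_commute) auto
    then show ?thesis using row[OF y] by simp
  qed
qed

lemma expectation_bsc_list:
  fixes f :: "bool list \<Rightarrow> real"
  assumes "length ps = n" "length x = n"
  shows "measure_pmf.expectation (bsc_list ps x) f = (\<Sum>y | length y = n. pmf (bsc_list ps x) y * f y)"
  using assms set_pmf_bsc_list[of ps x] by (intro expectation_finite_pmf finite_words) auto

lemma finite_set_state_pmf: "finite (set_pmf (pair_pmf (state_pmf q) (state_pmf q')))"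
  by (auto simp: state_pmf_def)

lemma finite_set_pmf_joint:
  assumes "Msz > 0" "\<And>m. m < Msz \<Longrightarrow> finite (set_pmf (enc m))"
  shows "finite (set_pmf (joint q1 q1s p1 p2 p1s p2s N B Msz enc))"
  using assms finite_set_pmf_iid_list[OF finite_set_state_pmf]
  by (auto simp: joint_def finite_set_pmf_bsc_list lessThan_empty_iff)

lemma leakage_nonneg:
  assumes "Msz > 0" "\<And>m. m < Msz \<Longrightarrow> finite (set_pmf (enc m))"
  shows "0 \<le> leakage q1 q1s p1 p2 p1s p2s N B Msz enc"
  unfolding leakage_def using finite_set_pmf_joint[OF assms] by (intro cond_mi_nonneg) auto

text \<open>Bound each entropy term by its tangent at 1/2; the linear corrections at
  \<open>p\<close> and \<open>1 - p\<close> cancel. The bound keeps the exponent of the dither size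
  nonnegative.\<close>

lemma Hb_le_1:
  assumes "0 \<le> p" "p \<le> 1"
  shows "Hb p \<le> 1"
proof -
  have "- (t * log 2 t) \<le> t + (1 / 2 - t) / ln 2" if "0 \<le> t" for t :: real
  proof (cases "t = 0")
    case False
    then have t: "t > 0" using that by simp
    have "log 2 (1 / (2 * t)) \<le> (1 / (2 * t) - 1) / ln 2"
      using log2_le[of "1 / (2 * t)" 1] t by simp
    then have "t * log 2 (1 / (2 * t)) \<le> t * ((1 / (2 * t) - 1) / ln 2)"
      using t by (intro mult_left_mono) auto
    also have "\<dots> = (1 / 2 - t) / ln 2" using t by (simp add: field_simps)
    also have "log 2 (1 / (2 * t)) = - 1 - log 2 t" using t by (simp add: log_divide_pos log_mult_pos)
    finally show ?thesis by (simp add: algebra_simps)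
  qed simp
  from this[of p] this[of "1 - p"] assms
  have "Hb p \<le> 1 + ((1 / 2 - p) / ln 2 + (1 / 2 - (1 - p)) / ln 2)" by (simp add: Hb_def)
  also have "(1 / 2 - p) / ln 2 + (1 / 2 - (1 - p)) / ln 2 = 0"
    by (simp flip: add_divide_distrib)
  finally show ?thesis by simp
qed

text \<open>One wiretap code: \<open>M\<close> messages, each owning \<open>L\<close> codewords
  among which the encoder picks at random, and a typicality margin \<open>\<epsilon>\<close> per
  symbol.\<close>

locale wiretap =
  fixes q1 q1s p1 p2 p1s p2s \<epsilon> :: real and N B M L :: nat
  assumes p: "0 \<le> p1" "p1 \<le> 1" "0 \<le> p2" "p2 \<le> 1" "0 \<le> p1s" "p1s \<le> 1" "0 \<le> p2s" "p2s \<le> 1"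
    and pos: "0 < N" "0 < B" "0 < M" "0 < L" "0 < \<epsilon>"
begin

abbreviation "law \<equiv> pair_pmf (state_pmf q1) (state_pmf q1s)"
abbreviation "states \<equiv> iid_list B law"
abbreviation "words \<equiv> {x :: bool list. length x = N * B}"
abbreviation "indices \<equiv> {..<M} \<times> {..<L}"
abbreviation main :: "(nat \<times> nat) list \<Rightarrow> real list" where
  "main S \<equiv> block_xover p1 p2 fst N B S"
abbreviation eve :: "(nat \<times> nat) list \<Rightarrow> real list" where
  "eve S \<equiv> block_xover p1s p2s snd N B S"
abbreviation "h \<equiv> measure_pmf.expectation law (\<lambda>s. Hb (xover p1 p2 (fst s)))"
abbreviation "hs \<equiv> measure_pmf.expectation law (\<lambda>s. Hb (xover p1s p2s (snd s)))"
abbreviation "msg \<equiv> pmf_of_set {..<M}"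
abbreviation "dither \<equiv> pmf_of_set {..<L}"

definition enc :: "(nat \<times> nat \<Rightarrow> bool list) \<Rightarrow> nat \<Rightarrow> bool list pmf" where
  "enc c m = map_pmf (\<lambda>l. c (m, l)) dither"

text \<open>The sent word typically has normalized likelihood near
  \<open>2 powr (real N * real B * (1 - h))\<close>; the test concedes \<open>\<epsilon>\<close> per
  symbol.\<close>

definition threshold :: real where
  "threshold = 2 powr (real N * real B * (1 - h - \<epsilon>))"

text \<open>The pair of message and dither is decoded and the dither discarded. With no candidate or
  several, the choice is arbitrary; the error bound counts these cases as failures.\<close>

definition dec :: "(nat \<times> nat \<Rightarrow> bool list) \<Rightarrow> bool list \<Rightarrow> (nat \<times> nat) list \<Rightarrow> nat" where
  "dec c y S = fst (SOME i. i \<in> indices \<and> threshold < card words * pmf (bsc_list (main S) (c i)) y)"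

lemma fin_states: "finite (set_pmf states)"
  by (intro finite_set_pmf_iid_list finite_set_state_pmf)

lemma fin_msg: "finite (set_pmf msg)" and fin_dither: "finite (set_pmf dither)"
  using pos by (auto simp: lessThan_empty_iff)

lemma set_msg: "set_pmf msg = {..<M}" and set_dither: "set_pmf dither = {..<L}"
  using pos by (auto simp: lessThan_empty_iff)

lemma words_ne: "words \<noteq> {}"
  using card_words[of "N * B"] by force

lemma fin_uniform: "finite (set_pmf (pmf_of_set words))"
  using finite_words words_ne by simp

lemma xover_01: "\<forall>p\<in>set (main S). 0 \<le> p \<and> p \<le> 1" "\<forall>p\<in>set (eve S). 0 \<le> p \<and> p \<le> 1"
  using set_block_xover[of p1 p2 fst N B S] set_block_xover[of p1s p2s snd N B S] p by auto

text \<open>For fixed states each receiver sees a doubly stochastic channel on \<open>words\<close>.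
  The codebook law does not involve \<open>S\<close>, so one ensemble serves all states and both
  channels.\<close>

sublocale M: random_code words indices undefined "\<lambda>x y. pmf (bsc_list (main S) x) y" for S
  using pmf_bsc_list_doubly_stochastic[OF _ xover_01(1)] words_ne
  by unfold_locales (auto simp: finite_words)

sublocale E: random_code words indices undefined "\<lambda>x y. pmf (bsc_list (eve S) x) y" for S
  using pmf_bsc_list_doubly_stochastic[OF _ xover_01(2)] words_ne
  by unfold_locales (auto simp: finite_words)

abbreviation "code \<equiv> Pi_pmf indices undefined (\<lambda>_. pmf_of_set words)"

lemma code_length: "c \<in> set_pmf code \<Longrightarrow> i \<in> indices \<Longrightarrow> length (c i) = N * B"
  using finite_words words_ne by (auto simp: set_Pi_pmf PiE_dflt_def)

text \<open>If the sent pair passes the test and no other pair does, the choice in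
  \<open>dec\<close> is forced and correct. Otherwise one of the indicators on the right equals
  1.\<close>

lemma err_prob_le:
  assumes c: "c \<in> set_pmf code"
  shows "err_prob q1 q1s p1 p2 p1s p2s N B M (enc c) (dec c)
    \<le> measure_pmf.expectation msg (\<lambda>m. measure_pmf.expectation dither (\<lambda>l.
         measure_pmf.expectation states (\<lambda>S. \<Sum>y\<in>words. pmf (bsc_list (main S) (c (m, l))) y *
           (of_bool (card words * pmf (bsc_list (main S) (c (m, l))) y \<le> threshold)
             + (\<Sum>j\<in>indices - {(m, l)}. of_bool (threshold < card words * pmf (bsc_list (main S) (c j)) y))))))"
proof -
  have "err_prob q1 q1s p1 p2 p1s p2s N B M (enc c) (dec c)
     = measure_pmf.expectation (joint q1 q1s p1 p2 p1s p2s N B M (enc c)) (\<lambda>(m, S, y, z). of_bool (dec c y S \<noteq> m))"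
  proof -
    have "(\<lambda>(m, S, y, z). of_bool (dec c y S \<noteq> m)) = (indicator {(m, S, y, z). dec c y S \<noteq> m} :: _ \<times> _ \<times> _ \<times> bool list \<Rightarrow> real)"
      by (auto simp: fun_eq_iff indicator_def)
    then show ?thesis unfolding err_prob_def by simp
  qed
  also have "\<dots> = measure_pmf.expectation msg (\<lambda>m. measure_pmf.expectation dither (\<lambda>l.
         measure_pmf.expectation states (\<lambda>S. measure_pmf.expectation (bsc_list (main S) (c (m, l)))
           (\<lambda>y. of_bool (dec c y S \<noteq> m)))))"
    unfolding joint_def block_xover_def[symmetric]
    using fin_states fin_msg fin_dither
    by (simp add: expectation_bind_finite finite_set_pmf_bsc_list enc_def bind_map_pmf)
  also have "\<dots> \<le> measure_pmf.expectation msg (\<lambda>m. measure_pmf.expectation dither (\<lambda>l.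
         measure_pmf.expectation states (\<lambda>S. \<Sum>y\<in>words. pmf (bsc_list (main S) (c (m, l))) y *
           (of_bool (card words * pmf (bsc_list (main S) (c (m, l))) y \<le> threshold)
             + (\<Sum>j\<in>indices - {(m, l)}. of_bool (threshold < card words * pmf (bsc_list (main S) (c j)) y))))))"
  proof (intro expectation_mono_finite fin_msg fin_dither fin_states)
    fix m l S
    assume "m \<in> set_pmf msg" "l \<in> set_pmf dither"
    then have i: "(m, l) \<in> indices" by (simp add: set_msg set_dither)
    let ?P = "\<lambda>y i. threshold < card words * pmf (bsc_list (main S) (c i)) y"
    have "of_bool (dec c y S \<noteq> m) \<le> (of_bool (\<not> ?P y (m, l))
             + (\<Sum>j\<in>indices - {(m, l)}. of_bool (?P y j)) :: real)" for y
    proof (cases "?P y (m, l) \<and> (\<forall>j\<in>indices - {(m, l)}. \<not> ?P y j)")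
      case True
      then have "(SOME i. i \<in> indices \<and> ?P y i) = (m, l)"
        using i by (intro some_equality) auto
      then have "dec c y S = m" by (simp add: dec_def)
      then show ?thesis by (simp add: sum_nonneg)
    next
      case False
      show ?thesis
      proof (cases "?P y (m, l)")
        case True
        then obtain j where j: "j \<in> indices - {(m, l)}" "?P y j" using False by blast
        have "(of_bool (?P y j) :: real) \<le> (\<Sum>j\<in>indices - {(m, l)}. of_bool (?P y j))"
          using j(1) by (intro member_le_sum) auto
        then show ?thesis using j(2) by (simp add: of_bool_def split: if_splits)
      qed (simp add: sum_nonneg of_bool_def)
    qed
    then show "measure_pmf.expectation (bsc_list (main S) (c (m, l))) (\<lambda>y. of_bool (dec c y S \<noteq> m))
      \<le> (\<Sum>y\<in>words. pmf (bsc_list (main S) (c (m, l))) y *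
           (of_bool (card words * pmf (bsc_list (main S) (c (m, l))) y \<le> threshold)
             + (\<Sum>j\<in>indices - {(m, l)}. of_bool (?P y j))))"
      unfolding not_less using code_length[OF c i]
      by (subst expectation_bsc_list[where n = "N * B"]) (auto intro!: sum_mono mult_left_mono)
  qed
  finally show ?thesis .
qed

text \<open>Given message and states, the eavesdropper sees the mixture of the output laws of the
  \<open>L\<close> codewords; the leakage is at most its mean divergence from the uniform
  law.\<close>

lemma leakage_le:
  assumes c: "c \<in> set_pmf code"
  shows "leakage q1 q1s p1 p2 p1s p2s N B M (enc c)
    \<le> measure_pmf.expectation msg (\<lambda>m. measure_pmf.expectation dither (\<lambda>l.
         measure_pmf.expectation states (\<lambda>S. \<Sum>z\<in>words. pmf (bsc_list (eve S) (c (m, l))) z *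
           log 2 (card words / card ({m} \<times> {..<L}) * (\<Sum>j\<in>{m} \<times> {..<L}. pmf (bsc_list (eve S) (c j)) z)))))"
proof -
  define K where "K m S = bind_pmf dither (\<lambda>l. bsc_list (eve S) (c (m, l)))" for m S
  have pmf_K: "pmf (K m S) z = (\<Sum>j\<in>{m} \<times> {..<L}. pmf (bsc_list (eve S) (c j)) z) / card ({m} \<times> {..<L})"
    for m S z
  proof -
    have "{m} \<times> {..<L} = Pair m ` {..<L}" by auto
    then show ?thesis
      using pos by (simp add: K_def pmf_bind integral_pmf_of_set lessThan_empty_iff sum.reindex card_image inj_on_def)
  qed
  have "map_pmf (\<lambda>(m, S, y, z). (m, z, S)) (joint q1 q1s p1 p2 p1s p2s N B M (enc c))
      = bind_pmf msg (\<lambda>m. bind_pmf (enc c m) (\<lambda>x. bind_pmf states (\<lambda>S.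
          map_pmf (\<lambda>z. (m, z, S)) (bsc_list (eve S) x))))"
    unfolding joint_def block_xover_def[symmetric]
    by (simp add: map_bind_pmf map_pmf_def[of "\<lambda>z. (_, z, _)"] bind_return_pmf)
  \<comment> \<open>The draws of codeword and states commute, since the encoder does not know the
    states.\<close>
  also have "\<dots> = bind_pmf msg (\<lambda>m. bind_pmf states (\<lambda>S. map_pmf (\<lambda>z. (m, z, S)) (K m S)))"
    by (subst bind_commute_pmf) (simp add: K_def enc_def bind_map_pmf map_bind_pmf)
  finally have "leakage q1 q1s p1 p2 p1s p2s N B M (enc c)
      \<le> measure_pmf.expectation msg (\<lambda>m. measure_pmf.expectation states (\<lambda>S.
          measure_pmf.expectation (K m S) (\<lambda>z. log 2 (card words * pmf (K m S) z))))"
    unfolding leakage_def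
  proof (intro cond_mi_le fin_msg fin_states finite_words)
    fix m S assume m: "m \<in> set_pmf msg"
    have "set_pmf (bsc_list (eve S) (c (m, l))) \<subseteq> words" if "l < L" for l
      using set_pmf_bsc_list[of "eve S" "c (m, l)"] code_length[OF c, of "(m, l)"] m that
      by (auto simp: set_msg)
    then show "set_pmf (K m S) \<subseteq> words"
      by (auto simp: K_def set_dither)
  qed
  \<comment> \<open>The average over the mixture becomes an average over the sent dither; the
    mixture remains inside the logarithm.\<close>
  also have "\<dots> = measure_pmf.expectation msg (\<lambda>m. measure_pmf.expectation dither (\<lambda>l.
         measure_pmf.expectation states (\<lambda>S. measure_pmf.expectation (bsc_list (eve S) (c (m, l)))
            (\<lambda>z. log 2 (card words * pmf (K m S) z)))))"
    by (subst expectation_swap_finite[OF fin_dither fin_states])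
       (simp add: K_def expectation_bind_finite[OF fin_dither finite_set_pmf_bsc_list])
  also have "\<dots> = measure_pmf.expectation msg (\<lambda>m. measure_pmf.expectation dither (\<lambda>l.
         measure_pmf.expectation states (\<lambda>S. \<Sum>z\<in>words. pmf (bsc_list (eve S) (c (m, l))) z *
            log 2 (card words * pmf (K m S) z))))"
    using code_length[OF c]
    by (intro integral_cong_AE)
       (auto simp: AE_measure_pmf_iff set_msg set_dither expectation_bsc_list[where n = "N * B"]
         intro!: integral_cong_AE)
  finally show ?thesis by (simp add: pmf_K)
qed

text \<open>The bound of \<open>log_likelihood_deviation\<close> for the main channel;
  \<open>tail_eve\<close> is its counterpart for the eavesdropper.\<close>

definition tail :: real where
  "tail = 2 * (log_var p1 + log_var p2) / (\<epsilon>\<^sup>2 * (real N * real B))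
     + 2 * measure_pmf.expectation law (\<lambda>s. (Hb (xover p1 p2 (fst s)) - h)\<^sup>2) / (\<epsilon>\<^sup>2 * B)"

definition tail_eve :: real where
  "tail_eve = 2 * (log_var p1s + log_var p2s) / (\<epsilon>\<^sup>2 * (real N * real B))
     + 2 * measure_pmf.expectation law (\<lambda>s. (Hb (xover p1s p2s (snd s)) - hs)\<^sup>2) / (\<epsilon>\<^sup>2 * B)"

lemma expectation_err_prob:
  "measure_pmf.expectation code (\<lambda>c. err_prob q1 q1s p1 p2 p1s p2s N B M (enc c) (dec c))
     \<le> tail + real (M * L) / threshold"
proof -
  let ?E = "measure_pmf.expectation" and ?U = "pmf_of_set words"
  define w where "w S x y = pmf (bsc_list (main S) x) y" for S x y
  define n where "n = real N * real B"
  define err where "err c m l S = (\<Sum>y\<in>words. w S (c (m, l)) y *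
           (of_bool (card words * w S (c (m, l)) y \<le> threshold)
             + (\<Sum>j\<in>indices - {(m, l)}. of_bool (threshold < card words * w S (c j) y))))"
    for c :: "nat \<times> nat \<Rightarrow> bool list" and m l S
  define small where "small S x = (\<Sum>y\<in>words. w S x y * of_bool (card words * w S x y \<le> threshold))" for S x
  have tpos: "threshold > 0" by (simp add: threshold_def)
  have "?E code (\<lambda>c. err_prob q1 q1s p1 p2 p1s p2s N B M (enc c) (dec c))
      \<le> ?E code (\<lambda>c. ?E msg (\<lambda>m. ?E dither (\<lambda>l. ?E states (\<lambda>S. err c m l S))))"
    unfolding err_def w_def by (intro expectation_mono_finite M.fin_code err_prob_le)
  \<comment> \<open>The codebook average moves inside, where message, dither and states are fixed
    and the ensemble bound applies.\<close>
  also have "\<dots> = ?E msg (\<lambda>m. ?E dither (\<lambda>l. ?E states (\<lambda>S. ?E code (\<lambda>c. err c m l S))))"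
    by (simp only: expectation_swap_finite[OF M.fin_code fin_msg]
        expectation_swap_finite[OF M.fin_code fin_dither] expectation_swap_finite[OF M.fin_code fin_states])
  also have "\<dots> \<le> ?E msg (\<lambda>m. ?E dither (\<lambda>l. ?E states (\<lambda>S. ?E ?U (small S) + card indices / threshold)))"
    unfolding err_def small_def w_def
    by (intro expectation_mono_finite fin_msg fin_dither fin_states M.expectation_error tpos)
       (simp add: set_msg set_dither)
  also have "\<dots> = ?E ?U (\<lambda>x. ?E states (\<lambda>S. small S x)) + real (M * L) / threshold"
    by (simp add: expectation_add_finite[OF fin_states] expectation_swap_finite[OF fin_states fin_uniform])
  also have "?E ?U (\<lambda>x. ?E states (\<lambda>S. small S x)) \<le> ?E ?U (\<lambda>x. tail)"
  proof (intro expectation_mono_finite fin_uniform)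
    fix x assume "x \<in> set_pmf ?U"
    then have x: "length x = N * B" using finite_words words_ne by simp
    have "?E states (\<lambda>S. small S x)
        = ?E states (\<lambda>S. ?E (bsc_list (main S) x) (\<lambda>y. of_bool (card words * w S x y \<le> threshold)))"
      using x by (simp add: small_def w_def expectation_bsc_list[where n = "N * B"])
    also have "\<dots> \<le> ?E states (\<lambda>S. ?E (bsc_list (main S) x)
         (\<lambda>y. of_bool (\<epsilon> * (real N * real B) \<le> \<bar>log 2 (w S x y) + real N * real B * h\<bar>)))"
    proof (intro expectation_mono_finite fin_states finite_set_pmf_bsc_list)
      fix S y assume "y \<in> set_pmf (bsc_list (main S) x)"
      then have wpos: "0 < w S x y" by (simp add: w_def pmf_positive)
      \<comment> \<open>Failing the threshold test forces a log-likelihood at least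
        \<open>\<epsilon> * n\<close> below its mean \<open>- n * h\<close>.\<close>
      have "\<epsilon> * n \<le> \<bar>log 2 (w S x y) + n * h\<bar>" if "card words * w S x y \<le> threshold"
      proof -
        have "log 2 (2 powr n * w S x y) \<le> log 2 threshold"
          using that wpos tpos by (subst log_le_cancel_iff) (auto simp: card_words n_def simp flip: powr_realpow)
        then have "n + log 2 (w S x y) \<le> n * (1 - h - \<epsilon>)"
          using wpos by (simp add: log_mult_pos threshold_def n_def)
        then have "\<epsilon> * n \<le> - (log 2 (w S x y) + n * h)" by (simp add: algebra_simps)
        then show ?thesis by linarith
      qed
      then show "of_bool (card words * w S x y \<le> threshold)
         \<le> (of_bool (\<epsilon> * (real N * real B) \<le> \<bar>log 2 (w S x y) + real N * real B * h\<bar>) :: real)"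
        by (auto simp: n_def)
    qed
    also have "\<dots> \<le> tail"
      unfolding tail_def w_def using p pos x
      by (intro log_likelihood_deviation finite_set_state_pmf refl) auto
    finally show "?E states (\<lambda>S. small S x) \<le> tail" .
  qed
  finally show ?thesis by simp
qed

text \<open>For typical outputs the covering ratio is at most 1 and the logarithm costs at most one
  bit; otherwise it costs at most \<open>n + 1\<close> bits, weighted by \<open>tail_eve\<close>.
  Divided by the block length, both contributions vanish.\<close>

lemma expectation_leakage:
  assumes L: "2 powr (real N * real B * (1 - hs + \<epsilon>)) \<le> L"
  shows "measure_pmf.expectation code (\<lambda>c. leakage q1 q1s p1 p2 p1s p2s N B M (enc c))
     \<le> 1 + (real N * real B + 1) * tail_eve"
proof -
  let ?E = "measure_pmf.expectation" and ?U = "pmf_of_set words"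
  define w where "w S x y = pmf (bsc_list (eve S) x) y" for S x y
  define n where "n = real N * real B"
  define dv where "dv c m l S = (\<Sum>z\<in>words. w S (c (m, l)) z *
           log 2 (card words / card ({m} \<times> {..<L}) * (\<Sum>j\<in>{m} \<times> {..<L}. w S (c j) z)))"
    for c :: "nat \<times> nat \<Rightarrow> bool list" and m l S
  define cover where "cover S = (\<lambda>x. \<Sum>z\<in>words. w S x z * log 2 (1 + card words * w S x z / L))" for S
  have "?E code (\<lambda>c. leakage q1 q1s p1 p2 p1s p2s N B M (enc c))
      \<le> ?E code (\<lambda>c. ?E msg (\<lambda>m. ?E dither (\<lambda>l. ?E states (\<lambda>S. dv c m l S))))"
    unfolding dv_def w_def by (intro expectation_mono_finite M.fin_code leakage_le)
  also have "\<dots> = ?E msg (\<lambda>m. ?E dither (\<lambda>l. ?E states (\<lambda>S. ?E code (\<lambda>c. dv c m l S))))"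
    by (simp only: expectation_swap_finite[OF M.fin_code fin_msg]
        expectation_swap_finite[OF M.fin_code fin_dither] expectation_swap_finite[OF M.fin_code fin_states])
  also have "\<dots> \<le> ?E msg (\<lambda>m. ?E dither (\<lambda>l. ?E states (\<lambda>S. ?E ?U (cover S))))"
  proof (intro expectation_mono_finite fin_msg fin_dither fin_states)
    fix m l S assume "m \<in> set_pmf msg" "l \<in> set_pmf dither"
    then show "?E code (\<lambda>c. dv c m l S) \<le> ?E ?U (cover S)"
      using E.expectation_divergence[of "{m} \<times> {..<L}" "(m, l)" S]
      by (auto simp: dv_def cover_def w_def set_msg set_dither)
  qed
  also have "\<dots> = ?E ?U (\<lambda>x. ?E states (\<lambda>S. cover S x))"
    by (simp add: expectation_swap_finite[OF fin_states fin_uniform])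
  also have "\<dots> \<le> ?E ?U (\<lambda>x. 1 + (real N * real B + 1) * tail_eve)"
  proof (intro expectation_mono_finite fin_uniform)
    fix x assume "x \<in> set_pmf ?U"
    then have x: "length x = N * B" using finite_words words_ne by simp
    let ?dev = "\<lambda>S y. of_bool (\<epsilon> * (real N * real B) \<le> \<bar>log 2 (w S x y) + real N * real B * hs\<bar>) :: real"
    have "?E states (\<lambda>S. cover S x)
        = ?E states (\<lambda>S. ?E (bsc_list (eve S) x) (\<lambda>z. log 2 (1 + card words * w S x z / L)))"
      using x by (simp add: cover_def w_def expectation_bsc_list[where n = "N * B"])
    also have "\<dots> \<le> ?E states (\<lambda>S. ?E (bsc_list (eve S) x) (\<lambda>z. 1 + (n + 1) * ?dev S z))"
    proof (intro expectation_mono_finite fin_states finite_set_pmf_bsc_list)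
      fix S z assume "z \<in> set_pmf (bsc_list (eve S) x)"
      then have wpos: "0 < w S x z" by (simp add: w_def pmf_positive)
      have n0: "n \<ge> 0" by (simp add: n_def)
      have cw: "real (card words) = 2 powr n"
        by (simp add: card_words n_def flip: powr_realpow)
      have Lr: "1 \<le> real L" using pos by simp
      show "log 2 (1 + card words * w S x z / L) \<le> 1 + (n + 1) * ?dev S z"
      proof (cases "\<epsilon> * n \<le> \<bar>log 2 (w S x z) + n * hs\<bar>")
        case True
        \<comment> \<open>Crude bound for atypical outputs: the likelihood is at most 1 and
          \<open>L\<close> at least 1.\<close>
        have "2 powr n * w S x z / L \<le> 2 powr n * 1 / 1"
          using wpos Lr by (intro frac_le mult_left_mono) (auto simp: w_def pmf_le_1)
        then have "1 + 2 powr n * w S x z / L \<le> 2 powr n + 2 powr n"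
          using ge_one_powr_ge_zero[of 2 n] n0 by simp
        also have "\<dots> = 2 powr (n + 1)" by (simp add: powr_add)
        finally have "log 2 (1 + 2 powr n * w S x z / L) \<le> log 2 (2 powr (n + 1))"
          using wpos Lr by (subst log_le_cancel_iff) (auto intro!: add_pos_nonneg)
        then show ?thesis using True by (simp add: cw n_def)
      next
        case False
        \<comment> \<open>For typical outputs the assumed size of \<open>L\<close> is exactly what
          brings the covering ratio down to 1.\<close>
        then have "log 2 (w S x z) < n * (\<epsilon> - hs)" by (simp add: algebra_simps)
        then have "w S x z < 2 powr (n * (\<epsilon> - hs))" using wpos by (simp add: log_less_iff)
        then have "2 powr n * w S x z \<le> 2 powr n * 2 powr (n * (\<epsilon> - hs))" by simp
        also have "\<dots> = 2 powr (n * (1 - hs + \<epsilon>))" by (simp add: algebra_simps flip: powr_add)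
        also have "\<dots> \<le> L" using L by (simp add: n_def)
        finally have "1 + 2 powr n * w S x z / L \<le> 2" using Lr by (simp add: field_simps)
        then have "log 2 (1 + 2 powr n * w S x z / L) \<le> log 2 2"
          using wpos Lr by (subst log_le_cancel_iff) (auto intro!: add_pos_nonneg)
        then show ?thesis using False by (simp add: cw n_def)
      qed
    qed
    also have "\<dots> = 1 + (n + 1) * ?E states (\<lambda>S. ?E (bsc_list (eve S) x) (?dev S))"
      by (simp add: expectation_add_finite[OF finite_set_pmf_bsc_list] expectation_add_finite[OF fin_states])
    also have "?E states (\<lambda>S. ?E (bsc_list (eve S) x) (?dev S)) \<le> tail_eve"
      unfolding tail_eve_def w_def using p pos x
      by (intro log_likelihood_deviation finite_set_state_pmf refl) auto
    finally show "?E states (\<lambda>S. cover S x) \<le> 1 + (real N * real B + 1) * tail_eve"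
      by (simp add: n_def mult_left_mono)
  qed
  finally show ?thesis by simp
qed

text \<open>A single codebook must be both reliable and secret, so the sum of the two criteria is
  averaged. As both are nonnegative, the bound on the sum controls each.\<close>

lemma exists_code:
  assumes L: "2 powr (real N * real B * (1 - hs + \<epsilon>)) \<le> L"
  shows "\<exists>e d. valid_code N B M e
     \<and> err_prob q1 q1s p1 p2 p1s p2s N B M e d \<ge> 0 \<and> leakage q1 q1s p1 p2 p1s p2s N B M e \<ge> 0
     \<and> err_prob q1 q1s p1 p2 p1s p2s N B M e d + leakage q1 q1s p1 p2 p1s p2s N B M e / (real N * real B)
        \<le> tail + real (M * L) / threshold + (1 + (real N * real B + 1) * tail_eve) / (real N * real B)"
proof -
  let ?err = "\<lambda>c. err_prob q1 q1s p1 p2 p1s p2s N B M (enc c) (dec c)"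
  let ?leak = "\<lambda>c. leakage q1 q1s p1 p2 p1s p2s N B M (enc c)"
  have "measure_pmf.expectation code (\<lambda>c. ?err c + ?leak c / (real N * real B))
      \<le> tail + real (M * L) / threshold + (1 + (real N * real B + 1) * tail_eve) / (real N * real B)"
    unfolding expectation_add_finite[OF M.fin_code] integral_divide_zero
    using pos by (intro add_mono expectation_err_prob divide_right_mono expectation_leakage L) auto
  from expectation_le_imp_ex[OF M.fin_code this] obtain c where c: "c \<in> set_pmf code"
    and le: "?err c + ?leak c / (real N * real B)
      \<le> tail + real (M * L) / threshold + (1 + (real N * real B + 1) * tail_eve) / (real N * real B)" by blast
  have "valid_code N B M (enc c)"
    using pos code_length[OF c] by (auto simp: valid_code_def enc_def set_dither)
  moreover have "?leak c \<ge> 0"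
    using pos fin_dither by (intro leakage_nonneg) (auto simp: enc_def)
  moreover have "?err c \<ge> 0" by (simp add: err_prob_def)
  ultimately show ?thesis using le by blast
qed

end

section \<open>Achievability\<close>

text \<open>A constant carries no information: the joint masses reduce to marginals and every
  logarithm has argument 1.\<close>

lemma cond_mi_const_fst:
  assumes "\<And>t. t \<in> set_pmf d \<Longrightarrow> fst t = a"
  shows "cond_mi d = 0"
  unfolding cond_mi_def
proof (intro sum.neutral ballI)
  let ?bc = "map_pmf (\<lambda>(a, b, c). (b, c)) d" and ?c = "map_pmf (\<lambda>(a, b, c). c) d"
  fix t assume t: "t \<in> set_pmf d"
  then obtain b c where t_eq: "t = (a, b, c)" using assms by (cases t) fastforce
  have bc: "0 < pmf ?bc (b, c)" and c: "0 < pmf ?c c"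
    using t by (force intro!: pmf_positive simp: t_eq)+
  have "map_pmf (Pair a) ?bc = map_pmf id d"
    unfolding map_pmf_comp using assms by (intro map_pmf_cong) fastforce+
  then have "pmf d (a, b, c) = pmf ?bc (b, c)"
    using pmf_map_inj'[of "Pair a" ?bc "(b, c)"] by (simp add: inj_on_def map_pmf_id)
  moreover have "map_pmf (Pair a) ?c = map_pmf (\<lambda>(a, b, c). (a, c)) d"
    unfolding map_pmf_comp using assms by (intro map_pmf_cong) fastforce+
  then have "pmf (map_pmf (\<lambda>(a, b, c). (a, c)) d) (a, c) = pmf ?c c"
    using pmf_map_inj'[of "Pair a" ?c c] by (simp add: inj_on_def)
  ultimately show "(case t of (a, b, c) \<Rightarrow> pmf d (a, b, c) * log 2 (pmf d (a, b, c) * pmf ?c c /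
      (pmf (map_pmf (\<lambda>(a, b, c). (a, c)) d) (a, c) * pmf ?bc (b, c)))) = 0"
    using bc c by (simp add: t_eq mult.commute)
qed

text \<open>A single message is decoded without error and leaks nothing. This settles the case of a
  claimed rate that is not positive.\<close>

lemma achievable_0: "achievable q1 q1s p1 p2 p1s p2s 0"
proof -
  define e :: "nat \<Rightarrow> nat \<Rightarrow> bool list pmf" where "e k m = return_pmf (replicate (Suc k * Suc k) False)" for k m
  have lt: "{..<Suc 0} = {0}" by auto
  have fst0: "fst t = 0" if "t \<in> set_pmf (joint q1 q1s p1 p2 p1s p2s (Suc k) (Suc k) 1 (e k))" for t k
    using that by (auto simp: joint_def lt)
  have err: "err_prob q1 q1s p1 p2 p1s p2s (Suc k) (Suc k) 1 (e k) (\<lambda>_ _. 0) = 0" for k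
    using fst0[of _ k] unfolding err_prob_def by (subst measure_pmf_zero_iff) fastforce
  have leak: "leakage q1 q1s p1 p2 p1s p2s (Suc k) (Suc k) 1 (e k) = 0" for k
    unfolding leakage_def using fst0[of _ k] by (intro cond_mi_const_fst[of _ 0]) fastforce
  show ?thesis
    unfolding achievable_def
    by (rule exI[of _ Suc], rule exI[of _ Suc], rule exI[of _ "\<lambda>_. 1"], rule exI[of _ e],
        rule exI[of _ "\<lambda>_ _ _. 0"])
       (use err leak in \<open>auto simp: valid_code_def e_def filterlim_Suc\<close>)
qed

section \<open>Rates up to the gap of the mean entropies\<close>

lemma expectation_state_pmf:
  assumes "0 \<le> q" "q \<le> 1"
  shows "measure_pmf.expectation (state_pmf q) (\<lambda>s. Hb (xover a b s)) = q * Hb a + (1 - q) * Hb b"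
  using assms by (simp add: state_pmf_def xover_def)

lemma achievable_below:
  fixes q1 q1s p1 p2 p1s p2s \<delta> :: real
  defines "h \<equiv> q1 * Hb p1 + (1 - q1) * Hb p2" and "hs \<equiv> q1s * Hb p1s + (1 - q1s) * Hb p2s"
  assumes q: "0 \<le> q1" "q1 \<le> 1" "0 \<le> q1s" "q1s \<le> 1"
    and p: "0 \<le> p1" "p1 \<le> 1" "0 \<le> p2" "p2 \<le> 1" "0 \<le> p1s" "p1s \<le> 1" "0 \<le> p2s" "p2s \<le> 1"
    and \<delta>: "0 < \<delta>" "\<delta> \<le> hs - h"
  shows "achievable q1 q1s p1 p2 p1s p2s (hs - h - \<delta>)"
proof -
  \<comment> \<open>The exponents of \<open>M\<close>, \<open>L\<close> and \<open>threshold\<close>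
    combine to \<open>- \<delta> + 2 * \<epsilon>\<close> per symbol, which is
    \<open>- (\<delta> / 2)\<close>.\<close>
  define \<epsilon> where "\<epsilon> = \<delta> / 4"
  \<comment> \<open>Block length and number of blocks are both \<open>Suc k\<close>, so every error
    term is a polynomial in \<open>u k\<close> or decays geometrically.\<close>
  define n where "n k = real (Suc k) * real (Suc k)" for k
  define u where "u k = inverse (real (Suc k))" for k
  define L where "L k = nat \<lceil>2 powr (n k * (1 - hs + \<epsilon>))\<rceil>" for k
  define M where "M k = nat \<lceil>2 powr (n k * (hs - h - \<delta>))\<rceil>" for k
  define law where "law = pair_pmf (state_pmf q1) (state_pmf q1s)"
  define A where "A = 2 * (log_var p1 + log_var p2) / \<epsilon>\<^sup>2"
  define As where "As = 2 * (log_var p1s + log_var p2s) / \<epsilon>\<^sup>2"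
  define D where "D = 2 * measure_pmf.expectation law (\<lambda>s. (Hb (xover p1 p2 (fst s)) - h)\<^sup>2) / \<epsilon>\<^sup>2"
  define Ds where "Ds = 2 * measure_pmf.expectation law (\<lambda>s. (Hb (xover p1s p2s (snd s)) - hs)\<^sup>2) / \<epsilon>\<^sup>2"
  \<comment> \<open>The three summands account for an atypical main output, competing codewords, and
    the normalized leakage.\<close>
  define bound where "bound k = (u k * u k * A + u k * D) + 4 * (2 powr - (\<delta> / 2)) ^ k
     + (u k * u k + (1 + u k * u k) * (u k * u k * As + u k * Ds))" for k
  have npos: "n k > 0" for k by (simp add: n_def)
  have nu: "inverse (n k) = u k * u k" for k by (simp add: n_def u_def)
  have hE: "measure_pmf.expectation law (\<lambda>s. Hb (xover p1 p2 (fst s))) = h"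
    using expectation_pair_pmf_fst[of "state_pmf q1" "state_pmf q1s" "\<lambda>s. Hb (xover p1 p2 s)"] q
    by (simp add: law_def h_def expectation_state_pmf)
  have hsE: "measure_pmf.expectation law (\<lambda>s. Hb (xover p1s p2s (snd s))) = hs"
    using expectation_pair_pmf_snd[of "state_pmf q1" "state_pmf q1s" "\<lambda>s. Hb (xover p1s p2s s)"] q
    by (simp add: law_def hs_def expectation_state_pmf)
  have "hs \<le> q1s * 1 + (1 - q1s) * 1"
    unfolding hs_def using q p by (intro add_mono mult_left_mono Hb_le_1) auto
  then have hs1: "hs \<le> 1" by simp
  \<comment> \<open>Rounding up at most doubles a power that is at least 1. The exponents are
    nonnegative: for \<open>L\<close> because \<open>hs \<le> 1\<close>, for \<open>M\<close>
    because \<open>\<delta> \<le> hs - h\<close>.\<close>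
  have ceil: "1 \<le> nat \<lceil>2 powr (n k * t)\<rceil> \<and> 2 powr (n k * t) \<le> nat \<lceil>2 powr (n k * t)\<rceil>
      \<and> nat \<lceil>2 powr (n k * t)\<rceil> \<le> 2 * 2 powr (n k * t)" if "0 \<le> t" for k t
  proof -
    have ge1: "1 \<le> 2 powr (n k * t)"
      using that npos[of k] by (intro ge_one_powr_ge_zero) auto
    then have "real_of_int \<lceil>2 powr (n k * t)\<rceil> \<le> 2 * 2 powr (n k * t)"
      using of_int_ceiling_le_add_one[of "2 powr (n k * t)"] by linarith
    with ge1 show ?thesis by (auto simp: le_nat_iff)
  qed
  have Lk: "1 \<le> L k" "2 powr (n k * (1 - hs + \<epsilon>)) \<le> L k" "L k \<le> 2 * 2 powr (n k * (1 - hs + \<epsilon>))" for k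
    using ceil[of "1 - hs + \<epsilon>" k] hs1 \<delta> by (auto simp: L_def \<epsilon>_def)
  have Mk: "1 \<le> M k" "2 powr (n k * (hs - h - \<delta>)) \<le> M k" "M k \<le> 2 * 2 powr (n k * (hs - h - \<delta>))" for k
    using ceil[of "hs - h - \<delta>" k] \<delta> by (auto simp: M_def)
  have size_ratio: "real (M k * L k) / 2 powr (n k * (1 - h - \<epsilon>)) \<le> 4 * (2 powr - (\<delta> / 2)) ^ k" for k
  proof -
    have "real (M k * L k) / 2 powr (n k * (1 - h - \<epsilon>))
      \<le> (2 * 2 powr (n k * (hs - h - \<delta>))) * (2 * 2 powr (n k * (1 - hs + \<epsilon>))) / 2 powr (n k * (1 - h - \<epsilon>))"
      unfolding of_nat_mult using Lk[of k] Mk[of k] by (intro divide_right_mono mult_mono) auto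
    also have "\<dots> = 4 * 2 powr (n k * (hs - h - \<delta>) + n k * (1 - hs + \<epsilon>) - n k * (1 - h - \<epsilon>))"
      by (simp add: powr_add powr_diff)
    also have "n k * (hs - h - \<delta>) + n k * (1 - hs + \<epsilon>) - n k * (1 - h - \<epsilon>) = n k * - (\<delta> / 2)"
      by (simp add: \<epsilon>_def algebra_simps)
    also have "2 powr (n k * - (\<delta> / 2)) \<le> 2 powr (real k * - (\<delta> / 2))"
    proof -
      have "real k \<le> n k" by (simp add: n_def algebra_simps)
      then have "real k * (\<delta> / 2) \<le> n k * (\<delta> / 2)" using \<delta> by (intro mult_right_mono) auto
      then show ?thesis by simp
    qed
    also have "2 powr (real k * - (\<delta> / 2)) = (2 powr - (\<delta> / 2)) ^ k"
      by (simp add: powr_power mult.commute)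
    finally show ?thesis by simp
  qed
  \<comment> \<open>Encoder and decoder are packed into one pair so that a single application of
    choice yields both sequences.\<close>
  have "\<exists>ed. valid_code (Suc k) (Suc k) (M k) (fst ed)
     \<and> err_prob q1 q1s p1 p2 p1s p2s (Suc k) (Suc k) (M k) (fst ed) (snd ed) \<ge> 0
     \<and> leakage q1 q1s p1 p2 p1s p2s (Suc k) (Suc k) (M k) (fst ed) \<ge> 0
     \<and> err_prob q1 q1s p1 p2 p1s p2s (Suc k) (Suc k) (M k) (fst ed) (snd ed)
        + leakage q1 q1s p1 p2 p1s p2s (Suc k) (Suc k) (M k) (fst ed) / n k \<le> bound k" for k
  proof -
    interpret wiretap q1 q1s p1 p2 p1s p2s \<epsilon> "Suc k" "Suc k" "M k" "L k"
      using p \<delta> Lk[of k] Mk[of k] by unfold_locales (auto simp: \<epsilon>_def)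
    have tails: "tail = u k * u k * A + u k * D" "tail_eve = u k * u k * As + u k * Ds"
      unfolding tail_def tail_eve_def law_def[symmetric] hE hsE n_def[symmetric]
      by (simp_all add: A_def As_def D_def Ds_def n_def u_def divide_inverse mult_ac del: of_nat_Suc)
    have "tail + real (M k * L k) / threshold + (1 + (n k + 1) * tail_eve) / n k \<le> bound k"
    proof -
      have "(1 + (n k + 1) * tail_eve) / n k = inverse (n k) + (1 + inverse (n k)) * tail_eve"
        using npos[of k] by (simp add: field_simps)
      then show ?thesis
        using size_ratio[of k] unfolding bound_def threshold_def law_def[symmetric] hE n_def[symmetric] nu tails
        by simp
    qed
    moreover obtain e d where "valid_code (Suc k) (Suc k) (M k) e"
      "err_prob q1 q1s p1 p2 p1s p2s (Suc k) (Suc k) (M k) e d \<ge> 0"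
      "leakage q1 q1s p1 p2 p1s p2s (Suc k) (Suc k) (M k) e \<ge> 0"
      "err_prob q1 q1s p1 p2 p1s p2s (Suc k) (Suc k) (M k) e d
        + leakage q1 q1s p1 p2 p1s p2s (Suc k) (Suc k) (M k) e / n k
        \<le> tail + real (M k * L k) / threshold + (1 + (n k + 1) * tail_eve) / n k"
    proof -
      have "2 powr (real (Suc k) * real (Suc k) *
          (1 - measure_pmf.expectation (pair_pmf (state_pmf q1) (state_pmf q1s)) (\<lambda>s. Hb (xover p1s p2s (snd s))) + \<epsilon>))
          \<le> L k"
        unfolding law_def[symmetric] hsE n_def[symmetric] by (rule Lk)
      from exists_code[OF this] that show ?thesis unfolding n_def by blast
    qed
    ultimately show ?thesis
      by (intro exI[of _ "(e, d)"] conjI; unfold fst_conv snd_conv; (assumption | linarith))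
  qed
  then have "\<forall>k. \<exists>ed. valid_code (Suc k) (Suc k) (M k) (fst ed)
     \<and> err_prob q1 q1s p1 p2 p1s p2s (Suc k) (Suc k) (M k) (fst ed) (snd ed) \<ge> 0
     \<and> leakage q1 q1s p1 p2 p1s p2s (Suc k) (Suc k) (M k) (fst ed) \<ge> 0
     \<and> err_prob q1 q1s p1 p2 p1s p2s (Suc k) (Suc k) (M k) (fst ed) (snd ed)
        + leakage q1 q1s p1 p2 p1s p2s (Suc k) (Suc k) (M k) (fst ed) / n k \<le> bound k" by blast
  from choice[OF this] obtain ed where
    valid: "\<And>k. valid_code (Suc k) (Suc k) (M k) (fst (ed k))" and
    err0: "\<And>k. err_prob q1 q1s p1 p2 p1s p2s (Suc k) (Suc k) (M k) (fst (ed k)) (snd (ed k)) \<ge> 0" and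
    leak0: "\<And>k. leakage q1 q1s p1 p2 p1s p2s (Suc k) (Suc k) (M k) (fst (ed k)) \<ge> 0" and
    le: "\<And>k. err_prob q1 q1s p1 p2 p1s p2s (Suc k) (Suc k) (M k) (fst (ed k)) (snd (ed k))
        + leakage q1 q1s p1 p2 p1s p2s (Suc k) (Suc k) (M k) (fst (ed k)) / n k \<le> bound k" by blast
  have leak0': "leakage q1 q1s p1 p2 p1s p2s (Suc k) (Suc k) (M k) (fst (ed k)) / n k \<ge> 0" for k
    using leak0[of k] npos[of k] by simp
  have u0: "u \<longlonglongrightarrow> 0" unfolding u_def by (rule LIMSEQ_inverse_real_of_nat)
  have pow0: "(\<lambda>k. (2 powr - (\<delta> / 2)) ^ k) \<longlonglongrightarrow> (0::real)"
    using \<delta> powr_less_mono[of "- (\<delta> / 2)" 0 2] by (intro LIMSEQ_realpow_zero) auto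
  have "bound \<longlonglongrightarrow> (0 * 0 * A + 0 * D) + 4 * 0 + (0 * 0 + (1 + 0 * 0) * (0 * 0 * As + 0 * Ds))"
    unfolding bound_def by (intro tendsto_intros u0 pow0)
  then have bound0: "bound \<longlonglongrightarrow> 0" by simp
  have err_le: "err_prob q1 q1s p1 p2 p1s p2s (Suc k) (Suc k) (M k) (fst (ed k)) (snd (ed k)) \<le> bound k" for k
    using le[of k] leak0'[of k] by linarith
  have leak_le: "leakage q1 q1s p1 p2 p1s p2s (Suc k) (Suc k) (M k) (fst (ed k)) / n k \<le> bound k" for k
    using le[of k] err0[of k] by linarith
  have err_lim: "(\<lambda>k. err_prob q1 q1s p1 p2 p1s p2s (Suc k) (Suc k) (M k) (fst (ed k)) (snd (ed k))) \<longlonglongrightarrow> 0"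
    by (rule tendsto_sandwich[OF _ _ tendsto_const bound0]) (use err0 err_le in simp_all)
  have leak_lim: "(\<lambda>k. leakage q1 q1s p1 p2 p1s p2s (Suc k) (Suc k) (M k) (fst (ed k)) / n k) \<longlonglongrightarrow> 0"
    by (rule tendsto_sandwich[OF _ _ tendsto_const bound0]) (use leak0' leak_le in simp_all)
  \<comment> \<open>\<open>M\<close> was rounded up, so the rate is met at every
    \<open>k\<close>.\<close>
  have rate: "hs - h - \<delta> \<le> log 2 (M k) / n k" for k
  proof -
    have "log 2 (2 powr (n k * (hs - h - \<delta>))) \<le> log 2 (M k)"
      using Mk[of k] by (subst log_le_cancel_iff) auto
    then show ?thesis using npos[of k] by (simp add: pos_le_divide_eq mult.commute)
  qed
  show ?thesis
    unfolding achievable_def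
  proof (rule exI[of _ Suc], rule exI[of _ Suc], rule exI[of _ M], rule exI[of _ "\<lambda>k. fst (ed k)"],
      rule exI[of _ "\<lambda>k. snd (ed k)"], intro conjI allI impI)
    fix e :: real assume "0 < e"
    show "\<forall>\<^sub>F k in sequentially. hs - h - \<delta> - e \<le> log 2 (real (M k)) / real (Suc k * Suc k)"
    proof (intro always_eventually allI)
      fix k
      show "hs - h - \<delta> - e \<le> log 2 (real (M k)) / real (Suc k * Suc k)"
        using rate[of k] \<open>0 < e\<close> unfolding n_def of_nat_mult by linarith
    qed
  qed (use valid err_lim leak_lim[unfolded n_def] in \<open>simp_all only: filterlim_Suc of_nat_mult\<close>)
qed

theorem theorem4:
  fixes q1 q1s p1 p2 p1s p2s :: real
  assumes "0 \<le> q1s" "q1s \<le> q1" "q1 \<le> 1"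
    and "0 \<le> p1" "p1 \<le> p1s" "p1s \<le> p2" "p2 \<le> p2s" "p2s \<le> 1/2"
  shows "ereal ((Hb p1s - Hb p1) * q1 + (Hb p2s - Hb p2) * (1 - q1s) + (Hb p2 - Hb p1s) * (q1 - q1s))
           \<le> Cs_CSI_D q1 q1s p1 p2 p1s p2s"
proof -
  define h where "h = q1 * Hb p1 + (1 - q1) * Hb p2"
  define hs where "hs = q1s * Hb p1s + (1 - q1s) * Hb p2s"
  have le_Cs: "ereal R \<le> Cs_CSI_D q1 q1s p1 p2 p1s p2s" if "achievable q1 q1s p1 p2 p1s p2s R" for R
    unfolding Cs_CSI_D_def using that by (intro Sup_upper) auto
  \<comment> \<open>Regrouped by entropies, the claimed expression telescopes to the difference of
    the mean entropies of the two channels.\<close>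
  have rate: "(Hb p1s - Hb p1) * q1 + (Hb p2s - Hb p2) * (1 - q1s) + (Hb p2 - Hb p1s) * (q1 - q1s) = hs - h"
    by (simp add: h_def hs_def algebra_simps)
  have "ereal (hs - h) \<le> Cs_CSI_D q1 q1s p1 p2 p1s p2s"
  proof (cases "0 < hs - h")
    case True
    have "ereal (hs - h) \<le> Cs_CSI_D q1 q1s p1 p2 p1s p2s + ereal e" if "0 < e" for e
    proof -
      \<comment> \<open>Capping the loss at \<open>hs - h\<close> keeps the rate nonnegative, as
        \<open>achievable_below\<close> demands.\<close>
      define \<delta> where "\<delta> = min e (hs - h)"
      have "0 < \<delta>" "\<delta> \<le> hs - h" using that True by (auto simp: \<delta>_def)
      then have "achievable q1 q1s p1 p2 p1s p2s (hs - h - \<delta>)"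
        unfolding h_def hs_def using assms by (intro achievable_below) linarith+
      then have "ereal (hs - h - \<delta>) + ereal e \<le> Cs_CSI_D q1 q1s p1 p2 p1s p2s + ereal e"
        by (rule add_right_mono[OF le_Cs])
      moreover have "ereal (hs - h) \<le> ereal (hs - h - \<delta>) + ereal e"
        by (simp add: \<delta>_def)
      ultimately show ?thesis by (rule order_trans[rotated])
    qed
    then show ?thesis by (rule ereal_le_epsilon2)
  next
    case False
    then have "ereal (hs - h) \<le> ereal 0" by simp
    also have "\<dots> \<le> Cs_CSI_D q1 q1s p1 p2 p1s p2s" by (rule le_Cs[OF achievable_0])
    finally show ?thesis .
  qed
  then show ?thesis unfolding rate .
qed

end
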